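(* Let $\mathbb{G}$ be a homogeneous group with Lie algebra $\mathrm{Lie}(\mathbb{G})=\mathcal{V}_1\oplus\cdots\oplus\mathcal{V}_\iota$, and let $\mathcal{S}\subseteq\mathcal{V}_1$ be an involutive sub-algebra (equivalently, since $[\mathcal{S},\mathcal{S}]\subseteq\mathcal{V}_2$, a linear subspace of $\mathcal{V}_1$ with $[\mathcal{S},\mathcal{S}]=0$), with basis $Y_1,\dots,Y_r$. Let $\Omega\subseteq\mathbb{G}$ be open, $T>0$, and let $b$ be a (time-dependent) Lipschitz horizontal vector field of the form $$b(t,x)=\sum_{i=1}^r a_i(t,x)\,Y_i(x),\qquad (t,x)\in[0,T]\times\Omega,$$ where each $a_i$ is continuous on $[0,T]\times\Omega$ and Lipschitz in $x\in\Omega$ with respect to a homogeneous distance on $\mathbb{G}$, uniformly in $t\in[0,T]$. Then, for every $x_0\in\Omega$, there exists a unique solution in $\Omega$ to the Cauchy problem $$\dot\gamma(t)=b(t,\gamma(t))\ \text{ for } t\in[0,T],\qquad \gamma(0)=x_0.$$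
   Context: A homogeneous group is a graded finite-dimensional real linear space $\mathbb{G}=H^1\oplus\cdots\oplus H^\iota$ equipped with a Lie algebra structure satisfying $[H^i,H^j]\subseteq H^{i+j}$ (with $H^k=\{0\}$ for $k>\iota$), and with the group operation given by the Baker-Campbell-Hausdorff formula; its identity is $0$. $\mathrm{Lie}(\mathbb{G})$ is the Lie algebra of left-invariant vector fields and $\mathcal{V}_j=\{X\in\mathrm{Lie}(\mathbb{G}):X(0)\in H^j\}$; the elements of $\mathcal{V}_1$ are the left-invariant horizontal vector fields. Dilations $\delta_r$, $r>0$, are the linear maps with $\delta_r(x)=r^jx$ for $x\in H^j$. A homogeneous distance is a left-invariant distance $d$ on $\mathbb{G}$ with $d(\delta_rx,\delta_ry)=r\,d(x,y)$ for all $x,y\in\mathbb{G}$, $r>0$; all such distances are bi-Lipschitz equivalent. A solution of the Cauchy problem in $\Omega$ is a continuous curve $\gamma:[0,T]\to\Omega$ with $\gamma(0)=x_0$ and $\gamma(t)=\gamma(0)+\int_0^t b(s,\gamma(s))\,ds$ for every $t\in[0,T]$ (in linear coordinates on $\mathbb{G}$).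
   Formalization: A solution on all of [0,T] in Ω need not exist (G=ℝ, Ω=(−1,1), b=d/dx, x₀=0, T=2); proved instead: uniqueness on every [0,τ], and either a solution on [0,T] in Ω exists or a solution converges to a boundary point of Ω at some τ≤T. *)

theory Defs
  imports "HOL-Analysis.Analysis"
begin

section \<open>The Baker-Campbell-Hausdorff formula\<close>

text \<open>
  Dynkin's form of the Baker-Campbell-Hausdorff series for \<open>log (exp x exp y)\<close> is
  \[ \sum_{n \ge 1} \frac{(-1)^{n-1}}{n} \sum_{p_i + q_i > 0}
     \frac{[x^{p_1} y^{q_1} \cdots x^{p_n} y^{q_n}]}
          {\bigl(\sum_i (p_i + q_i)\bigr)\, \prod_i p_i!\, q_i!} \]
  where \<open>[z\<^sub>1 z\<^sub>2 \<dots> z\<^sub>m] = [z\<^sub>1, [z\<^sub>2, [\<dots>, z\<^sub>m]]]\<close>. The pairs \<open>(p\<^sub>i, q\<^sub>i)\<close> are collected in a list.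
  In a graded Lie algebra with top layer \<open>N\<close> every bracket of more than \<open>N\<close> elements vanishes,
  so the full series is the finite sum over the words of total degree at most \<open>N\<close>.
\<close>

fun nested_bracket :: "('g::zero \<Rightarrow> 'g \<Rightarrow> 'g) \<Rightarrow> 'g list \<Rightarrow> 'g" where
  "nested_bracket br [] = 0"
| "nested_bracket br [z] = z"
| "nested_bracket br (z # zs) = br z (nested_bracket br zs)"

definition word_degree :: "(nat \<times> nat) list \<Rightarrow> nat" where
  "word_degree w = (\<Sum>(p, q)\<leftarrow>w. p + q)"

definition dynkin_words :: "nat \<Rightarrow> (nat \<times> nat) list set" where
  "dynkin_words N =
     {w. w \<noteq> [] \<and> (\<forall>(p, q) \<in> set w. p + q > 0) \<and> word_degree w \<le> N}"

definition dynkin_coeff :: "(nat \<times> nat) list \<Rightarrow> real" where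
  "dynkin_coeff w =
     (-1) ^ (length w - 1) /
     (real (length w) * real (word_degree w) * (\<Prod>(p, q)\<leftarrow>w. fact p * fact q))"

definition bch :: "nat \<Rightarrow> ('g::real_vector \<Rightarrow> 'g \<Rightarrow> 'g) \<Rightarrow> 'g \<Rightarrow> 'g \<Rightarrow> 'g" where
  "bch N br x y =
     (\<Sum>w\<in>dynkin_words N. dynkin_coeff w *\<^sub>R
        nested_bracket br (concat (map (\<lambda>(p, q). replicate p x @ replicate q y) w)))"

lemma finite_dynkin_words: "finite (dynkin_words N)"
proof (rule finite_subset)
  have deg: "length w \<le> word_degree w \<and> (\<forall>(p, q) \<in> set w. p + q \<le> word_degree w)"
    if "\<forall>(p, q) \<in> set w. p + q > 0" for w :: "(nat \<times> nat) list"
    using that by (induction w) (fastforce simp: word_degree_def)+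
  show "dynkin_words N \<subseteq> {w. set w \<subseteq> {..N} \<times> {..N} \<and> length w \<le> N}"
  proof
    fix w assume "w \<in> dynkin_words N"
    then have w: "\<forall>(p, q) \<in> set w. p + q > 0" "word_degree w \<le> N"
      by (auto simp: dynkin_words_def)
    then show "w \<in> {w. set w \<subseteq> {..N} \<times> {..N} \<and> length w \<le> N}"
      using deg[OF w(1)] by fastforce
  qed
  show "finite {w :: (nat \<times> nat) list. set w \<subseteq> {..N} \<times> {..N} \<and> length w \<le> N}"
    by (intro finite_lists_length_le) auto
qed


section \<open>Homogeneous groups\<close>

text \<open>
  The underlying finite-dimensional real linear space is a type of class \<open>euclidean_space\<close>;
  its inner product plays no role beyond providing the linear topology. \<open>H j\<close> is the layer of
  degree \<open>j\<close> (only indices \<open>j \<ge> 1\<close> are used) and \<open>br\<close> is the Lie bracket. That \<open>bch\<close> is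
  a group law with identity \<open>0\<close> and inverse \<open>- x\<close> follows from the other conditions; it is
  recorded as part of the structure.
\<close>

locale homogeneous_group =
  fixes H :: "nat \<Rightarrow> 'g::euclidean_space set"
    and \<iota> :: nat
    and br :: "'g \<Rightarrow> 'g \<Rightarrow> 'g"
    and mul :: "'g \<Rightarrow> 'g \<Rightarrow> 'g"
  assumes subspace_layer: "\<And>j. j \<ge> 1 \<Longrightarrow> subspace (H j)"
    and layer_trivial: "\<And>k. k > \<iota> \<Longrightarrow> H k = {0}"
    and layers_span: "\<And>x. \<exists>u. (\<forall>j\<in>{1..\<iota>}. u j \<in> H j) \<and> x = (\<Sum>j=1..\<iota>. u j)"
    and layers_independent:
      "\<And>u. \<lbrakk>\<forall>j\<in>{1..\<iota>}. u j \<in> H j; (\<Sum>j=1..\<iota>. u j) = 0\<rbrakk> \<Longrightarrow> \<forall>j\<in>{1..\<iota>}. u j = 0"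
    and bilinear_bracket: "bilinear br"
    and bracket_self: "\<And>x. br x x = 0"
    and jacobi: "\<And>x y z. br x (br y z) + br y (br z x) + br z (br x y) = 0"
    and bracket_layers:
      "\<And>i j x y. \<lbrakk>i \<ge> 1; j \<ge> 1; x \<in> H i; y \<in> H j\<rbrakk> \<Longrightarrow> br x y \<in> H (i + j)"
    and mul_bch: "\<And>x y. mul x y = bch \<iota> br x y"
    and group_law: "group mul 0 uminus"

definition dilation :: "(nat \<Rightarrow> 'g::real_vector set) \<Rightarrow> nat \<Rightarrow> real \<Rightarrow> 'g \<Rightarrow> 'g" where
  "dilation H \<iota> r =
     (THE D. linear D \<and> (\<forall>j\<in>{1..\<iota>}. \<forall>x\<in>H j. D x = r ^ j *\<^sub>R x))"

definition homogeneous_distance ::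
  "(nat \<Rightarrow> 'g::real_vector set) \<Rightarrow> nat \<Rightarrow> ('g \<Rightarrow> 'g \<Rightarrow> 'g) \<Rightarrow> ('g \<Rightarrow> 'g \<Rightarrow> real) \<Rightarrow> bool" where
  "homogeneous_distance H \<iota> mul d \<longleftrightarrow>
     Metric_space UNIV d \<and>
     (\<forall>z x y. d (mul z x) (mul z y) = d x y) \<and>
     (\<forall>r>0. \<forall>x y. d (dilation H \<iota> r x) (dilation H \<iota> r y) = r * d x y)"


section \<open>Left-invariant vector fields\<close>

text \<open>Vector fields are functions \<open>'g \<Rightarrow> 'g\<close>, every tangent space being identified with \<open>'g\<close>.\<close>

definition left_invariant ::
  "('g::euclidean_space \<Rightarrow> 'g \<Rightarrow> 'g) \<Rightarrow> ('g \<Rightarrow> 'g) \<Rightarrow> bool" where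
  "left_invariant mul X \<longleftrightarrow>
     (\<forall>x y. X (mul x y) = frechet_derivative (mul x) (at y) (X y))"

definition layer_fields ::
  "(nat \<Rightarrow> 'g::euclidean_space set) \<Rightarrow> ('g \<Rightarrow> 'g \<Rightarrow> 'g) \<Rightarrow> nat \<Rightarrow> ('g \<Rightarrow> 'g) set" where
  "layer_fields H mul j = {X. left_invariant mul X \<and> X 0 \<in> H j}"

definition field_bracket ::
  "('g::euclidean_space \<Rightarrow> 'g) \<Rightarrow> ('g \<Rightarrow> 'g) \<Rightarrow> 'g \<Rightarrow> 'g" where
  "field_bracket X Z x =
     frechet_derivative Z (at x) (X x) - frechet_derivative X (at x) (Z x)"

definition involutive_subalgebra :: "('g::euclidean_space \<Rightarrow> 'g) set \<Rightarrow> bool" where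
  "involutive_subalgebra S \<longleftrightarrow>
     (\<lambda>x. 0) \<in> S \<and>
     (\<forall>X\<in>S. \<forall>Z\<in>S. (\<lambda>x. X x + Z x) \<in> S) \<and>
     (\<forall>c. \<forall>X\<in>S. (\<lambda>x. c *\<^sub>R X x) \<in> S) \<and>
     (\<forall>X\<in>S. \<forall>Z\<in>S. field_bracket X Z \<in> S)"

definition basis_of_fields ::
  "('g::euclidean_space \<Rightarrow> 'g) set \<Rightarrow> nat \<Rightarrow> (nat \<Rightarrow> 'g \<Rightarrow> 'g) \<Rightarrow> bool" where
  "basis_of_fields S r Y \<longleftrightarrow>
     (\<forall>i\<in>{1..r}. Y i \<in> S) \<and>
     (\<forall>X\<in>S. \<exists>c :: nat \<Rightarrow> real. X = (\<lambda>x. \<Sum>i=1..r. c i *\<^sub>R Y i x)) \<and>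
     (\<forall>c :: nat \<Rightarrow> real. (\<lambda>x. \<Sum>i=1..r. c i *\<^sub>R Y i x) = (\<lambda>x. 0) \<longrightarrow> (\<forall>i\<in>{1..r}. c i = 0))"


section \<open>The Cauchy problem\<close>

definition cauchy_solution ::
  "(real \<Rightarrow> 'g::euclidean_space \<Rightarrow> 'g) \<Rightarrow> 'g set \<Rightarrow> 'g \<Rightarrow> real \<Rightarrow> (real \<Rightarrow> 'g) \<Rightarrow> bool" where
  "cauchy_solution b \<Omega> x0 \<tau> \<gamma> \<longleftrightarrow>
     continuous_on {0..\<tau>} \<gamma> \<and> (\<forall>t\<in>{0..\<tau>}. \<gamma> t \<in> \<Omega>) \<and> \<gamma> 0 = x0 \<and>
     (\<forall>t\<in>{0..\<tau>}. ((\<lambda>s. b s (\<gamma> s)) has_integral (\<gamma> t - \<gamma> 0)) {0..t})"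

text \<open>
  A curve in \<open>\<Omega>\<close> on \<open>[0,\<tau>)\<close> that solves the problem on every shorter interval and reaches a
  boundary point of \<open>\<Omega>\<close> at time \<open>\<tau>\<close>. For open \<open>\<Omega>\<close> this is the obstruction to a solution in \<open>\<Omega>\<close>
  up to time \<open>\<tau>\<close>: with \<open>\<Omega> = (-1,1)\<close>, \<open>b = 1\<close> and \<open>x0 = 0\<close> on the real line the solution exits
  at \<open>\<tau> = 1\<close>. It cannot occur if \<open>\<Omega>\<close> is the whole space, whose frontier is empty.
\<close>

definition exits_through_boundary ::
  "(real \<Rightarrow> 'g::euclidean_space \<Rightarrow> 'g) \<Rightarrow> 'g set \<Rightarrow> 'g \<Rightarrow> real \<Rightarrow> (real \<Rightarrow> 'g) \<Rightarrow> bool" where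
  "exits_through_boundary b \<Omega> x0 \<tau> \<gamma> \<longleftrightarrow>
     (\<forall>s\<in>{0..<\<tau>}. cauchy_solution b \<Omega> x0 s \<gamma>) \<and>
     (\<exists>z\<in>frontier \<Omega>. (\<gamma> \<longlongrightarrow> z) (at_left \<tau>))"

end

theory Submission
  imports Defs
begin

text \<open>
  Let \<open>V\<close> be the space of values at \<open>0\<close> of the fields in \<open>S\<close>. For \<open>X, Z \<in> S\<close> the bracket
  \<open>[X(0), Z(0)]\<close> lies in the second layer by the grading and in the first one by involutivity, so it
  vanishes; hence the group operation restricted to \<open>V\<close> is addition and each \<open>Y\<^sub>i\<close> is constant on \<open>V\<close>.
  If \<open>\<gamma>\<close> is a solution and \<open>u(t) = \<Sum>\<^sub>i (\<integral>\<^sub>0\<^sup>t a\<^sub>i(s, \<gamma>(s)) ds) Y\<^sub>i(0)\<close>, then \<open>\<gamma>(t) (- u(t))\<close> has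
  derivative zero, so \<open>\<gamma> = x\<^sub>0 u\<close>. The Cauchy problem is therefore equivalent to
  \<open>u' = \<Sum>\<^sub>i a\<^sub>i(t, x\<^sub>0 u) Y\<^sub>i(0)\<close>, \<open>u(0) = 0\<close>, in \<open>V\<close>. A homogeneous distance is bounded on each coset
  of \<open>V\<close> by a multiple of the Euclidean one, so the reduced field is Lipschitz and the classical
  Cauchy-Lipschitz theory applies.
\<close>

section \<open>Lipschitz fields on open sets\<close>

text \<open>Gronwall's inequality in differential form: \<open>exp (- C * x) * z x - E * x\<close>
  is nonincreasing. It serves uniqueness with \<open>E = 0\<close> and the speed bound with
  \<open>E > 0\<close> allowed.\<close>

lemma exp_bound_of_derivative_le:
  fixes z z' :: "real \<Rightarrow> real"
  assumes "0 \<le> C" "0 \<le> E"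
    and cont: "continuous_on {0..s} z"
    and der: "\<And>x. x \<in> {0<..<s} \<Longrightarrow> (z has_real_derivative z' x) (at x)"
    and le: "\<And>x. x \<in> {0<..<s} \<Longrightarrow> z' x \<le> C * z x + E"
    and t: "t \<in> {0..s}"
  shows "z t \<le> exp (C * t) * (z 0 + E * t)"
proof -
  let ?h = "\<lambda>x. exp (- C * x) * z x - E * x"
  have "?h t \<le> ?h 0"
  proof (rule DERIV_nonpos_imp_decreasing_open[of 0 t ?h])
    show "continuous_on {0..t} ?h"
      using t by (intro continuous_intros continuous_on_subset[OF cont]) auto
    fix x assume x: "0 < x" "x < t"
    then have xs: "x \<in> {0<..<s}" using t by auto
    let ?d = "exp (- C * x) * (z' x - C * z x) - E"
    have "(?h has_real_derivative ?d) (at x)"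
      by (rule derivative_eq_intros der[OF xs] refl | simp add: algebra_simps)+
    moreover have "exp (- C * x) * (z' x - C * z x) \<le> exp (- C * x) * E"
      using le[OF xs] by (intro mult_left_mono) auto
    moreover have "exp (- C * x) * E \<le> 1 * E"
      using x assms(1,2) by (intro mult_right_mono) auto
    ultimately show "\<exists>y. (?h has_real_derivative y) (at x) \<and> y \<le> 0"
      by (intro exI[of _ ?d]) linarith
  qed (use t in auto)
  then have "exp (- C * t) * z t \<le> z 0 + E * t" by simp
  then have "exp (C * t) * (exp (- C * t) * z t) \<le> exp (C * t) * (z 0 + E * t)"
    by (intro mult_left_mono) auto
  then show ?thesis by (simp add: mult.assoc[symmetric] exp_add[symmetric])
qed

section \<open>Elementary properties of integral solutions and the Picard iteration\<close>

lemma cauchy_solution_restrict: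
  assumes "cauchy_solution b \<Omega> x0 \<tau> \<gamma>" "\<sigma> \<le> \<tau>"
  shows "cauchy_solution b \<Omega> x0 \<sigma> \<gamma>"
  using assms unfolding cauchy_solution_def by (auto intro: continuous_on_subset)

lemma cauchy_solution_cong:
  assumes "cauchy_solution b \<Omega> x0 \<tau> \<gamma>" "0 \<le> \<tau>" "\<And>t. t \<in> {0..\<tau>} \<Longrightarrow> \<gamma> t = \<eta> t"
  shows "cauchy_solution b \<Omega> x0 \<tau> \<eta>"
proof -
  have "continuous_on {0..\<tau>} \<eta>"
    using assms continuous_on_cong unfolding cauchy_solution_def by metis
  moreover have "((\<lambda>s. b s (\<eta> s)) has_integral \<eta> t - \<eta> 0) {0..t}" if t: "t \<in> {0..\<tau>}" for t
  proof -
    have "((\<lambda>s. b s (\<gamma> s)) has_integral \<eta> t - \<eta> 0) {0..t}"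
      using assms t unfolding cauchy_solution_def by fastforce
    then show ?thesis
      by (rule has_integral_eq[rotated]) (use assms(3) t in auto)
  qed
  ultimately show ?thesis
    using assms unfolding cauchy_solution_def by fastforce
qed

text \<open>Passage from the integral to the differential form. Continuity is required only along
  the curve, because the field is controlled only on \<open>{0..T}\<close> times its spatial
  domain.\<close>

lemma cauchy_solution_has_vector_derivative:
  assumes sol: "cauchy_solution b \<Omega> x0 \<tau> \<gamma>"
    and cont: "continuous_on {0..\<tau>} (\<lambda>s. b s (\<gamma> s))"
    and t: "t \<in> {0..\<tau>}"
  shows "(\<gamma> has_vector_derivative b t (\<gamma> t)) (at t within {0..\<tau>})"
proof -
  have "((\<lambda>u. \<gamma> 0 + integral {0..u} (\<lambda>s. b s (\<gamma> s))) has_vector_derivative 0 + b t (\<gamma> t))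
      (at t within {0..\<tau>})"
    by (intro has_vector_derivative_add has_vector_derivative_const
        integral_has_vector_derivative[OF cont t])
  moreover have "\<gamma> 0 + integral {0..u} (\<lambda>s. b s (\<gamma> s)) = \<gamma> u" if "u \<in> {0..\<tau>}" for u
  proof -
    have "((\<lambda>s. b s (\<gamma> s)) has_integral (\<gamma> u - \<gamma> 0)) {0..u}"
      using sol that unfolding cauchy_solution_def by blast
    then show ?thesis by (simp add: integral_unique)
  qed
  ultimately show ?thesis
    by (intro has_vector_derivative_transform[OF t, of \<gamma>
          "\<lambda>u. \<gamma> 0 + integral {0..u} (\<lambda>s. b s (\<gamma> s))"]) auto
qed

text \<open>The factor \<open>1/2\<close> makes the integral operator a contraction for the supremum norm.\<close>

lemma picard_short_interval:
  fixes g :: "real \<Rightarrow> 'a::euclidean_space \<Rightarrow> 'a"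
  assumes cont: "continuous_on ({p..q} \<times> UNIV) (\<lambda>(t, x). g t x)"
    and lip: "\<And>t x y. t \<in> {p..q} \<Longrightarrow> norm (g t x - g t y) \<le> K * norm (x - y)"
    and "p \<le> q" "0 \<le> K" and short: "K * (q - p) \<le> 1 / 2"
  obtains u where "continuous_on {p..q} u" "u p = u0"
    "\<And>t. t \<in> {p..q} \<Longrightarrow> ((\<lambda>s. g s (u s)) has_integral (u t - u p)) {p..t}"
proof -
  \<comment> \<open>Clamping time to \<open>{p..q}\<close> lets the integral operator act on bounded
    continuous functions on the whole line, a complete space. The values of \<open>F \<phi>\<close>
    are then those on a compact interval, hence bounded.\<close>
  define c where "c t = max p (min q t)" for t
  have c: "c t \<in> {p..q}" for t using \<open>p \<le> q\<close> by (auto simp: c_def)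
  have c_id: "c t = t" if "t \<in> {p..q}" for t using that by (auto simp: c_def)
  have cont_c: "continuous_on UNIV c" unfolding c_def by (intro continuous_intros)
  have gcont: "continuous_on {p..q} (\<lambda>s. g s (\<phi> s))" if "continuous_on {p..q} \<phi>" for \<phi>
  proof -
    have "continuous_on {p..q} ((\<lambda>(t, x). g t x) \<circ> (\<lambda>s. (s, \<phi> s)))"
      by (intro continuous_on_compose continuous_on_subset[OF cont] continuous_on_Pair
          continuous_on_id that) auto
    then show ?thesis by (simp add: o_def)
  qed
  define F where "F \<phi> t = u0 + integral {p..c t} (\<lambda>s. g s (apply_bcontfun \<phi> s))"
    for \<phi> :: "real \<Rightarrow>\<^sub>C 'a" and t
  have gi: "(\<lambda>s. g s (apply_bcontfun \<phi> s)) integrable_on {p..t}" if "t \<le> q" for \<phi> t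
    using that by (intro integrable_continuous_interval continuous_on_subset[OF gcont]) auto
  have Fc: "continuous_on {p..q} (\<lambda>t. u0 + integral {p..t} (\<lambda>s. g s (apply_bcontfun \<phi> s)))" for \<phi>
    using gi[of q] by (intro continuous_intros indefinite_integral_continuous_1) auto
  have F: "F \<phi> \<in> bcontfun" for \<phi>
  proof -
    have "continuous_on UNIV (F \<phi>)"
      unfolding F_def using c by (intro continuous_on_compose2[OF Fc cont_c]) auto
    moreover have "range (F \<phi>) \<subseteq>
        (\<lambda>t. u0 + integral {p..t} (\<lambda>s. g s (apply_bcontfun \<phi> s))) ` {p..q}"
      unfolding F_def using c by blast
    then have "bounded (range (F \<phi>))"
      using compact_continuous_image[OF Fc compact_Icc] compact_imp_bounded bounded_subset by metis
    ultimately show ?thesis by (simp add: bcontfun_def)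
  qed
  define P where "P \<phi> = Bcontfun (F \<phi>)" for \<phi>
  have P: "apply_bcontfun (P \<phi>) = F \<phi>" for \<phi>
    unfolding P_def using F by (simp add: Bcontfun_inverse)
  have contraction: "dist (P \<phi>) (P \<psi>) \<le> 1 / 2 * dist \<phi> \<psi>" for \<phi> \<psi>
  proof (rule dist_bound)
    fix t
    let ?d = "\<lambda>s. g s (apply_bcontfun \<phi> s) - g s (apply_bcontfun \<psi> s)"
    have ct: "p \<le> c t" "c t \<le> q" using c[of t] by auto
    have int: "(?d has_integral F \<phi> t - F \<psi> t) (cbox p (c t))"
      unfolding F_def using gi[OF ct(2)] by (simp add: has_integral_diff integrable_integral)
    have bound: "norm (?d s) \<le> K * dist \<phi> \<psi>" if "s \<in> cbox p (c t)" for s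
    proof -
      have "norm (?d s) \<le> K * dist (apply_bcontfun \<phi> s) (apply_bcontfun \<psi> s)"
        using lip[of s] that ct by (auto simp: dist_norm)
      also have "\<dots> \<le> K * dist \<phi> \<psi>" by (intro mult_left_mono dist_bounded \<open>0 \<le> K\<close>)
      finally show ?thesis .
    qed
    have "norm (F \<phi> t - F \<psi> t) \<le> K * dist \<phi> \<psi> * (c t - p)"
      using has_integral_bound[OF _ int bound] \<open>0 \<le> K\<close> ct by simp
    also have "\<dots> \<le> K * dist \<phi> \<psi> * (q - p)"
      using ct \<open>0 \<le> K\<close> by (intro mult_left_mono) auto
    also have "\<dots> = K * (q - p) * dist \<phi> \<psi>" by simp
    also have "\<dots> \<le> 1 / 2 * dist \<phi> \<psi>" using short by (intro mult_right_mono) auto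
    finally show "dist (apply_bcontfun (P \<phi>) t) (apply_bcontfun (P \<psi>) t) \<le> 1 / 2 * dist \<phi> \<psi>"
      by (simp add: P dist_norm)
  qed
  have "\<exists>!\<phi>. P \<phi> = \<phi>"
    by (rule banach_fix_type[of "1 / 2"]) (use contraction in auto)
  then obtain \<phi> where \<phi>: "P \<phi> = \<phi>" by blast
  have fixpoint: "apply_bcontfun \<phi> t = u0 + integral {p..t} (\<lambda>s. g s (apply_bcontfun \<phi> s))"
    if "t \<in> {p..q}" for t
    using fun_cong[OF P[of \<phi>], of t] unfolding \<phi> F_def c_id[OF that] .
  have p: "apply_bcontfun \<phi> p = u0" using fixpoint[of p] \<open>p \<le> q\<close> by simp
  show ?thesis
  proof (rule that[of "apply_bcontfun \<phi>"])
    show "((\<lambda>s. g s (\<phi> s)) has_integral (\<phi> t - \<phi> p)) {p..t}" if t: "t \<in> {p..q}" for t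
      unfolding p using integrable_integral[OF gi[of t \<phi>]] fixpoint[OF t] t by simp
  qed (auto simp: p)
qed

section \<open>Cauchy-Lipschitz theory on an open set: uniqueness, prolongation and exit\<close>

locale lipschitz_field =
  fixes f :: "real \<Rightarrow> 'a::euclidean_space \<Rightarrow> 'a" and D :: "'a set" and T K :: real
  assumes open_domain: "open D"
    and K_nonneg: "0 \<le> K"
    and continuous_field: "continuous_on ({0..T} \<times> D) (\<lambda>(t, x). f t x)"
    and lipschitz_field:
      "\<And>t x y. \<lbrakk>t \<in> {0..T}; x \<in> D; y \<in> D\<rbrakk> \<Longrightarrow> norm (f t x - f t y) \<le> K * norm (x - y)"
begin

lemma continuous_along:
  assumes "continuous_on I u" "I \<subseteq> {0..T}" "u ` I \<subseteq> D"
  shows "continuous_on I (\<lambda>s. f s (u s))"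
proof -
  have "continuous_on I ((\<lambda>(t, x). f t x) \<circ> (\<lambda>s. (s, u s)))"
    using assms by (intro continuous_on_compose continuous_on_subset[OF continuous_field]
        continuous_on_Pair continuous_on_id) auto
  then show ?thesis by (simp add: o_def)
qed

lemma solution_has_vector_derivative:
  assumes "cauchy_solution f D x0 s u" "s \<le> T" "t \<in> {0..s}"
  shows "(u has_vector_derivative f t (u t)) (at t within {0..s})"
  using assms
  by (intro cauchy_solution_has_vector_derivative continuous_along)
    (auto simp: cauchy_solution_def)

text \<open>Gronwall's inequality is applied to the squared distance of the two solutions, which is
  differentiable where the distance need not be, and which vanishes at time
  \<open>0\<close>.\<close>

lemma solution_unique:
  assumes u: "cauchy_solution f D x0 s u" and v: "cauchy_solution f D x0 s v"
    and "s \<le> T" and t: "t \<in> {0..s}"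
  shows "u t = v t"
proof -
  let ?z = "\<lambda>t. (u t - v t) \<bullet> (u t - v t)"
  let ?z' = "\<lambda>t. 2 * ((u t - v t) \<bullet> (f t (u t) - f t (v t)))"
  have "?z t \<le> exp (2 * K * t) * (?z 0 + 0 * t)"
  proof (rule exp_bound_of_derivative_le[where z' = ?z' and s = s])
    show "continuous_on {0..s} ?z"
      using u v unfolding cauchy_solution_def by (intro continuous_intros) auto
    fix x assume x: "x \<in> {0<..<s}"
    then have at: "at x within {0..s} = at x" by (intro at_within_interior) auto
    have "((\<lambda>t. u t - v t) has_vector_derivative f x (u x) - f x (v x)) (at x)"
      using solution_has_vector_derivative[OF u \<open>s \<le> T\<close>, of x]
        solution_has_vector_derivative[OF v \<open>s \<le> T\<close>, of x] x
      unfolding at by (intro has_vector_derivative_diff) auto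
    then have "((\<lambda>t. u t - v t) has_derivative (\<lambda>h. h *\<^sub>R (f x (u x) - f x (v x)))) (at x)"
      by (simp add: has_vector_derivative_def)
    from has_derivative_inner[OF this this]
    show "(?z has_real_derivative ?z' x) (at x)"
      unfolding has_field_derivative_def
      by (rule has_derivative_eq_rhs) (simp add: inner_commute algebra_simps fun_eq_iff)
    have "(u x - v x) \<bullet> (f x (u x) - f x (v x)) \<le> norm (u x - v x) * norm (f x (u x) - f x (v x))"
      by (rule norm_cauchy_schwarz)
    also have "\<dots> \<le> norm (u x - v x) * (K * norm (u x - v x))"
      using x u v \<open>s \<le> T\<close> unfolding cauchy_solution_def
      by (intro mult_left_mono lipschitz_field) auto
    finally show "?z' x \<le> 2 * K * ?z x + 0"
      by (simp add: power2_norm_eq_inner[symmetric] power2_eq_square algebra_simps)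
  qed (use t K_nonneg in auto)
  also have "\<dots> = 0" using u v by (simp add: cauchy_solution_def)
  finally show ?thesis by (metis eq_iff_diff_eq_0 inner_eq_zero_iff inner_ge_zero order_antisym)
qed

text \<open>Composing \<open>f\<close> with the nearest-point projection onto a closed ball in
  \<open>D\<close> gives a field on the whole space with the same Lipschitz constant. Its Picard
  solution stays in the ball for a short time, and there the projection is the identity.\<close>

lemma local_solution:
  assumes p: "p \<in> {0..<T}" and y: "y \<in> D"
  obtains q u where "p < q" "q \<le> T" "continuous_on {p..q} u" "u p = y"
    "\<And>t. t \<in> {p..q} \<Longrightarrow> u t \<in> D"
    "\<And>t. t \<in> {p..q} \<Longrightarrow> ((\<lambda>s. f s (u s)) has_integral (u t - u p)) {p..t}"
proof -
  obtain e where e: "0 < e" "cball y e \<subseteq> D"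
    using open_domain y open_contains_cball by blast
  define \<pi> where "\<pi> = closest_point (cball y e)"
  have \<pi>_in: "\<pi> x \<in> cball y e" for x
    unfolding \<pi>_def using e by (intro closest_point_in_set) auto
  have \<pi>_lip: "norm (\<pi> x - \<pi> x') \<le> norm (x - x')" for x x'
    using closest_point_lipschitz[of "cball y e" x x'] e by (simp add: \<pi>_def dist_norm)
  have \<pi>_cont: "continuous_on A \<pi>" for A
    unfolding \<pi>_def using e by (intro continuous_on_closest_point) auto
  have \<pi>_id: "\<pi> x = x" if "x \<in> cball y e" for x
    using that by (simp add: \<pi>_def closest_point_self)
  \<comment> \<open>The step \<open>1 / (2 * K + 2)\<close> ensures
    \<open>K * (q - p) \<le> 1 / 2\<close> and is also meaningful for \<open>K = 0\<close>.\<close>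
  define q where "q = min T (p + 1 / (2 * K + 2))"
  have q: "p < q" "q \<le> T" using p K_nonneg by (auto simp: q_def)
  have "K * (q - p) \<le> K * (1 / (2 * K + 2))"
    using K_nonneg by (intro mult_left_mono) (auto simp: q_def)
  also have "\<dots> \<le> 1 / 2" using K_nonneg by (simp add: field_simps)
  finally have short: "K * (q - p) \<le> 1 / 2" .
  obtain u where u: "continuous_on {p..q} u" "u p = y"
      "\<And>t. t \<in> {p..q} \<Longrightarrow> ((\<lambda>s. f s (\<pi> (u s))) has_integral (u t - u p)) {p..t}"
  proof (rule picard_short_interval[where g = "\<lambda>t x. f t (\<pi> x)" and ?u0.0 = y])
    show "continuous_on ({p..q} \<times> UNIV) (\<lambda>(t, x). f t (\<pi> x))"
    proof -
      have "continuous_on ({p..q} \<times> UNIV) ((\<lambda>(t, x). f t x) \<circ> (\<lambda>z. (fst z, \<pi> (snd z))))"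
        using \<pi>_in e p q
        by (intro continuous_on_compose continuous_on_subset[OF continuous_field] continuous_on_Pair
            continuous_on_fst continuous_on_id continuous_on_compose2[OF \<pi>_cont[of UNIV]]
            continuous_on_snd) auto
      then show ?thesis by (simp add: o_def case_prod_unfold)
    qed
    show "norm (f t (\<pi> x) - f t (\<pi> x')) \<le> K * norm (x - x')" if "t \<in> {p..q}" for t x x'
    proof -
      have "norm (f t (\<pi> x) - f t (\<pi> x')) \<le> K * norm (\<pi> x - \<pi> x')"
        using that p q \<pi>_in e by (intro lipschitz_field) auto
      also have "\<dots> \<le> K * norm (x - x')"
        using K_nonneg by (intro mult_left_mono \<pi>_lip)
      finally show ?thesis .
    qed
  qed (use q K_nonneg short in auto)
  have "(u \<longlongrightarrow> y) (at p within {p..q})"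
    using u(1,2) q by (auto simp: continuous_on_def)
  then have "\<forall>\<^sub>F t in at p within {p..q}. dist (u t) y < e"
    using e by (simp add: tendsto_iff)
  then obtain \<delta> where \<delta>: "0 < \<delta>" "\<And>t. t \<in> {p..q} \<Longrightarrow> t \<noteq> p \<Longrightarrow> dist t p < \<delta> \<Longrightarrow> dist (u t) y < e"
    unfolding eventually_at by blast
  \<comment> \<open>Half of \<open>\<delta>\<close> keeps the closed interval strictly within
    distance \<open>\<delta>\<close> of \<open>p\<close>.\<close>
  define q' where "q' = min q (p + \<delta> / 2)"
  have ball: "u t \<in> cball y e" if "t \<in> {p..q'}" for t
    using \<delta>(2)[of t] that u(2) e by (cases "t = p") (fastforce simp: q'_def dist_real_def dist_commute)+
  show ?thesis
  proof (rule that[of q' u])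
    show "p < q'" "q' \<le> T" using q \<delta> by (auto simp: q'_def)
    show "continuous_on {p..q'} u" by (rule continuous_on_subset[OF u(1)]) (auto simp: q'_def)
    show "u t \<in> D" if "t \<in> {p..q'}" for t using ball[OF that] e by auto
    show "((\<lambda>s. f s (u s)) has_integral (u t - u p)) {p..t}" if "t \<in> {p..q'}" for t
    proof (rule has_integral_eq)
      show "((\<lambda>s. f s (\<pi> (u s))) has_integral (u t - u p)) {p..t}"
        using that by (intro u(3)) (auto simp: q'_def)
      show "f s (\<pi> (u s)) = f s (u s)" if "s \<in> {p..t}" for s
        using ball[of s] \<pi>_id \<open>t \<in> _\<close> that by auto
    qed
  qed (rule u(2))
qed

text \<open>A local solution started at the end point \<open>u s\<close> is glued to
  \<open>u\<close>; the two integral equations add up over \<open>{0..s}\<close> and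
  \<open>{s..t}\<close>.\<close>

lemma extend_solution:
  assumes u: "cauchy_solution f D x0 s u" and s: "s \<in> {0..<T}"
  obtains q v where "s < q" "q \<le> T" "cauchy_solution f D x0 q v"
proof -
  have "u s \<in> D" using u s by (auto simp: cauchy_solution_def)
  then obtain q v where q: "s < q" "q \<le> T" and v: "continuous_on {s..q} v" "v s = u s"
    "\<And>t. t \<in> {s..q} \<Longrightarrow> v t \<in> D"
    "\<And>t. t \<in> {s..q} \<Longrightarrow> ((\<lambda>x. f x (v x)) has_integral (v t - v s)) {s..t}"
    by (rule local_solution[OF s]) blast
  define w where "w t = (if t \<le> s then u t else v t)" for t
  have w_v: "w t = v t" if "t \<in> {s..q}" for t using that v(2) by (auto simp: w_def)
  have us: "cauchy_solution f D x0 s w"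
    by (rule cauchy_solution_cong[OF u]) (use s in \<open>auto simp: w_def\<close>)
  have "continuous_on ({0..s} \<union> {s..q}) w"
  proof (rule continuous_on_closed_Un)
    show "continuous_on {s..q} w" using v(1) w_v continuous_on_cong by metis
  qed (use us in \<open>auto simp: cauchy_solution_def\<close>)
  moreover have "{0..s} \<union> {s..q} = {0..q}" using s q by auto
  moreover have "((\<lambda>x. f x (w x)) has_integral (w t - w 0)) {0..t}" if t: "t \<in> {0..q}" for t
  proof (cases "t \<le> s")
    case True
    then show ?thesis using us t by (auto simp: cauchy_solution_def)
  next
    case False
    have "((\<lambda>x. f x (w x)) has_integral (w t - w s)) {s..t}"
    proof (rule has_integral_eq)
      show "((\<lambda>x. f x (v x)) has_integral (w t - w s)) {s..t}"
        using v(4)[of t] w_v False t by auto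
    qed (use w_v t in auto)
    moreover have "((\<lambda>x. f x (w x)) has_integral (w s - w 0)) {0..s}"
      using us s by (auto simp: cauchy_solution_def)
    ultimately show ?thesis
      using has_integral_combine[of 0 s t "\<lambda>x. f x (w x)"] False s by fastforce
  qed
  moreover have "w t \<in> D" if "t \<in> {0..q}" for t
    using us v(3) w_v that by (cases "t \<le> s") (auto simp: cauchy_solution_def)
  moreover have "w 0 = x0" using us by (simp add: cauchy_solution_def)
  ultimately have "cauchy_solution f D x0 q w" by (simp add: cauchy_solution_def)
  with q that show ?thesis by blast
qed

text \<open>The global Lipschitz constant gives linear growth away from \<open>x0\<close>.
  Gronwall's inequality then confines all solutions up to time \<open>T\<close> to one ball around
  \<open>x0\<close>, so that \<open>M\<close> depends neither on the solution nor on its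
  lifetime.\<close>

lemma solution_speed_bound:
  assumes "x0 \<in> D" "0 \<le> T"
  obtains M where "0 \<le> M"
    "\<And>s u t. \<lbrakk>cauchy_solution f D x0 s u; s \<le> T; t \<in> {0..s}\<rbrakk> \<Longrightarrow> norm (f t (u t)) \<le> M"
proof -
  have "continuous_on {0..T} (\<lambda>s. f s x0)"
    using assms by (intro continuous_along) auto
  then have "bounded ((\<lambda>s. f s x0) ` {0..T})"
    by (intro compact_imp_bounded compact_continuous_image) auto
  then obtain A where A: "0 \<le> A" "\<And>t. t \<in> {0..T} \<Longrightarrow> norm (f t x0) \<le> A"
    unfolding bounded_pos using less_imp_le by (metis imageI)
  have speed: "norm (f t x) \<le> A + K * norm (x - x0)" if "t \<in> {0..T}" "x \<in> D" for t x
    using norm_triangle_sub[of "f t x" "f t x0"] A(2)[OF that(1)]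
      lipschitz_field[OF that \<open>x0 \<in> D\<close>] by linarith
  \<comment> \<open>The Gronwall bound at time \<open>T\<close> for the squared distance to
    \<open>x0\<close>, whose initial value is \<open>0\<close>. The constants
    \<open>2 * K + 1\<close> and \<open>A\<^sup>2\<close> come from splitting
    \<open>2 * (A * w) \<le> A\<^sup>2 + w\<^sup>2\<close>.\<close>
  define R where "R = exp ((2 * K + 1) * T) * (A\<^sup>2 * T)"
  have R: "0 \<le> R" using assms by (simp add: R_def)
  have dist: "norm (u t - x0) \<le> sqrt R"
    if u: "cauchy_solution f D x0 s u" and "s \<le> T" and t: "t \<in> {0..s}" for s u t
  proof -
    let ?z = "\<lambda>t. (u t - x0) \<bullet> (u t - x0)"
    let ?z' = "\<lambda>t. 2 * ((u t - x0) \<bullet> f t (u t))"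
    have "?z t \<le> exp ((2 * K + 1) * t) * (?z 0 + A\<^sup>2 * t)"
    proof (rule exp_bound_of_derivative_le[where z' = ?z' and s = s])
      show "continuous_on {0..s} ?z"
        using u unfolding cauchy_solution_def by (intro continuous_intros) auto
      fix x assume x: "x \<in> {0<..<s}"
      then have at: "at x within {0..s} = at x" by (intro at_within_interior) auto
      have "((\<lambda>t. u t - x0) has_vector_derivative f x (u x) - 0) (at x)"
        using solution_has_vector_derivative[OF u \<open>s \<le> T\<close>, of x] x
        unfolding at by (intro has_vector_derivative_diff has_vector_derivative_const) auto
      then have "((\<lambda>t. u t - x0) has_derivative (\<lambda>h. h *\<^sub>R f x (u x))) (at x)"
        by (simp add: has_vector_derivative_def)
      from has_derivative_inner[OF this this]
      show "(?z has_real_derivative ?z' x) (at x)"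
        unfolding has_field_derivative_def
        by (rule has_derivative_eq_rhs) (simp add: inner_commute algebra_simps fun_eq_iff)
      let ?w = "norm (u x - x0)"
      have "(u x - x0) \<bullet> f x (u x) \<le> ?w * norm (f x (u x))"
        by (rule norm_cauchy_schwarz)
      also have "\<dots> \<le> ?w * (A + K * ?w)"
        using x u \<open>s \<le> T\<close> unfolding cauchy_solution_def
        by (intro mult_left_mono speed) auto
      finally have "?z' x \<le> 2 * (A * ?w) + 2 * K * ?w\<^sup>2"
        by (simp add: power2_eq_square algebra_simps)
      moreover have "2 * (A * ?w) \<le> A\<^sup>2 + ?w\<^sup>2"
        using sum_squares_bound[of A ?w] by simp
      moreover have "?z x = ?w\<^sup>2" by (simp add: power2_norm_eq_inner)
      ultimately show "?z' x \<le> (2 * K + 1) * ?z x + A\<^sup>2"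
        by (simp add: algebra_simps)
    qed (use t K_nonneg in auto)
    also have "\<dots> \<le> R"
      unfolding R_def using u t \<open>s \<le> T\<close> K_nonneg
      by (intro mult_mono) (auto simp: cauchy_solution_def intro!: mult_left_mono)
    finally show ?thesis
      by (intro real_le_rsqrt) (simp add: power2_norm_eq_inner)
  qed
  show ?thesis
  proof (rule that[of "A + K * sqrt R"])
    fix s u t assume "cauchy_solution f D x0 s u" "s \<le> T" "t \<in> {0..s}"
    moreover from this have "norm (f t (u t)) \<le> A + K * norm (u t - x0)"
      unfolding cauchy_solution_def by (intro speed) auto
    ultimately show "norm (f t (u t)) \<le> A + K * sqrt R"
      using mult_left_mono[OF dist K_nonneg, of s u t] by linarith
  qed (use A K_nonneg R in auto)
qed

text \<open>The speed bound gives the maximal solution a limit at its final time; if this limit were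
  in \<open>D\<close>, the solution could be prolonged.\<close>

theorem solution_or_exit:
  assumes x0: "x0 \<in> D" and "0 < T"
  shows "(\<exists>u. cauchy_solution f D x0 T u) \<or>
    (\<exists>\<tau>\<in>{0<..T}. \<exists>u. exits_through_boundary f D x0 \<tau> u)"
proof -
  define A where "A = {s \<in> {0..T}. \<exists>u. cauchy_solution f D x0 s u}"
  define \<sigma> where "\<sigma> = Sup A"
  \<comment> \<open>At each time \<open>U\<close> evaluates some solution that lives up to that
    time. By uniqueness it agrees on \<open>{0..s}\<close> with every solution up to
    \<open>s\<close>, so one curve serves all \<open>s \<in> A\<close>.\<close>
  define U where "U t = (SOME u. cauchy_solution f D x0 t u) t" for t
  have "cauchy_solution f D x0 0 (\<lambda>_. x0)"
    using x0 by (auto simp: cauchy_solution_def has_integral_refl(2))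
  then have A0: "0 \<in> A" using \<open>0 < T\<close> by (auto simp: A_def)
  have bdd: "bdd_above A" by (auto simp: A_def)
  have \<sigma>: "0 \<le> \<sigma>" "\<sigma> \<le> T"
    unfolding \<sigma>_def using A0 bdd by (auto intro: cSup_upper) (auto intro!: cSup_least simp: A_def)
  have sol: "cauchy_solution f D x0 s U" if s: "s \<in> A" for s
  proof -
    obtain u where u: "cauchy_solution f D x0 s u" using s by (auto simp: A_def)
    show ?thesis
    proof (rule cauchy_solution_cong[OF u])
      fix t assume t: "t \<in> {0..s}"
      then have ut: "cauchy_solution f D x0 t u"
        using u cauchy_solution_restrict by auto
      then have "cauchy_solution f D x0 t (SOME u. cauchy_solution f D x0 t u)"
        by (rule someI[of "cauchy_solution f D x0 t"])
      then show "u t = U t"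
        unfolding U_def using solution_unique[OF ut] s t by (auto simp: A_def)
    qed (use s in \<open>auto simp: A_def\<close>)
  qed
  have below: "s \<in> A" if s: "0 \<le> s" "s < \<sigma>" for s
  proof -
    obtain s' where "s' \<in> A" "s < s'" using less_cSupD[of A s] s A0 unfolding \<sigma>_def by blast
    then show ?thesis using s cauchy_solution_restrict[of f D x0 s' _ s]
      by (fastforce simp: A_def)
  qed
  show ?thesis
  proof (cases "\<sigma> \<in> A")
    case True
    have "\<sigma> = T"
    proof (rule ccontr)
      assume "\<sigma> \<noteq> T"
      then obtain q v where "\<sigma> < q" "q \<le> T" "cauchy_solution f D x0 q v"
        using extend_solution[OF sol[OF True]] \<sigma> by auto
      then have "q \<in> A" using \<sigma> by (auto simp: A_def)
      then show False using cSup_upper[OF _ bdd, of q] \<open>\<sigma> < q\<close> by (simp add: \<sigma>_def)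
    qed
    then show ?thesis using sol[OF True] by auto
  next
    case False
    then have "0 < \<sigma>" using A0 \<sigma> by (cases "\<sigma> = 0") auto
    obtain M where M: "0 \<le> M"
        "\<And>s u t. \<lbrakk>cauchy_solution f D x0 s u; s \<le> T; t \<in> {0..s}\<rbrakk> \<Longrightarrow> norm (f t (u t)) \<le> M"
      using solution_speed_bound[OF x0] \<open>0 < T\<close> by (metis less_imp_le)
    have lip: "norm (U t - U t') \<le> M * (t - t')" if t: "t \<in> {0..<\<sigma>}" "t' \<in> {0..t}" for t t'
    proof -
      have tA: "t \<in> A" using t below by auto
      then have "t \<le> T" by (auto simp: A_def)
      have "((\<lambda>s. f s (U s)) has_integral (U t - U t')) {t'..t}"
      proof (rule fundamental_theorem_of_calculus)
        show "(U has_vector_derivative f s (U s)) (at s within {t'..t})" if "s \<in> {t'..t}" for s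
          using solution_has_vector_derivative[OF sol[OF tA] \<open>t \<le> T\<close>, of s] that t
          by (auto intro: has_vector_derivative_within_subset)
      qed (use t in auto)
      then show ?thesis
        using has_integral_bound[of M "\<lambda>s. f s (U s)" "U t - U t'" t' t]
          M(1) M(2)[OF sol[OF tA] \<open>t \<le> T\<close>] t by auto
    qed
    \<comment> \<open>Uniform continuity yields a continuous extension \<open>g\<close> to the
      closed interval. It has to replace \<open>U\<close>, whose value at \<open>\<sigma>\<close> is
      arbitrary because no solution up to \<open>\<sigma>\<close> exists in this case.\<close>
    have "M-lipschitz_on {0..<\<sigma>} U"
    proof (rule lipschitz_onI[OF _ M(1)])
      fix t t' assume "t \<in> {0..<\<sigma>}" "t' \<in> {0..<\<sigma>}"
      then show "dist (U t) (U t') \<le> M * dist t t'"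
        using lip[of t t'] lip[of t' t]
        by (cases "t' \<le> t") (auto simp: dist_norm norm_minus_commute)
    qed
    then obtain g where g: "uniformly_continuous_on (closure {0..<\<sigma>}) g"
        "\<And>t. t \<in> {0..<\<sigma>} \<Longrightarrow> U t = g t"
      using uniformly_continuous_on_extension_on_closure[OF lipschitz_on_uniformly_continuous]
      by metis
    have g_cont: "continuous_on {0..\<sigma>} g"
      using uniformly_continuous_imp_continuous[OF g(1)] \<open>0 < \<sigma>\<close> by simp
    have g_sol: "cauchy_solution f D x0 s g" if "s \<in> {0..<\<sigma>}" for s
      using that by (intro cauchy_solution_cong[OF sol[OF below]] g(2)) auto
    have g_D: "g t \<in> D" if "t \<in> {0..<\<sigma>}" for t
      using g_sol[OF that] that by (auto simp: cauchy_solution_def)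
    have g0: "g 0 = x0" using g_sol[of 0] \<open>0 < \<sigma>\<close> by (simp add: cauchy_solution_def)
    have "g \<sigma> \<notin> D"
    proof
      assume "g \<sigma> \<in> D"
      then have D: "g t \<in> D" if "t \<in> {0..\<sigma>}" for t
        using that g_D by (cases "t = \<sigma>") auto
      have int: "(\<lambda>s. f s (g s)) integrable_on {0..\<sigma>}"
        using g_cont D \<sigma> by (intro integrable_continuous_interval continuous_along) auto
      \<comment> \<open>Both sides of the integral equation are continuous on the closed interval,
        so the equation passes from the dense half-open interval to \<open>\<sigma>\<close>.\<close>
      have eq: "g t - x0 - integral {0..t} (\<lambda>s. f s (g s)) = 0" if "t \<in> {0..\<sigma>}" for t
      proof (rule continuous_constant_on_closure[of "{0..<\<sigma>}"])
        show "continuous_on (closure {0..<\<sigma>}) (\<lambda>t. g t - x0 - integral {0..t} (\<lambda>s. f s (g s)))"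
          using \<open>0 < \<sigma>\<close> g_cont int
          by (auto intro!: continuous_on_diff continuous_on_const indefinite_integral_continuous_1)
        show "g t - x0 - integral {0..t} (\<lambda>s. f s (g s)) = 0" if "t \<in> {0..<\<sigma>}" for t
        proof -
          have "((\<lambda>s. f s (g s)) has_integral (g t - g 0)) {0..t}"
            using g_sol[OF that] that unfolding cauchy_solution_def by auto
          then show ?thesis using g0 by (simp add: integral_unique)
        qed
      qed (use that \<open>0 < \<sigma>\<close> in auto)
      have "((\<lambda>s. f s (g s)) has_integral (g t - g 0)) {0..t}" if "t \<in> {0..\<sigma>}" for t
      proof -
        have "(\<lambda>s. f s (g s)) integrable_on {0..t}"
          using integrable_subinterval_real[OF int, of 0 t] that by auto
        then show ?thesis using eq[OF that] g0 by (simp add: has_integral_iff)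
      qed
      then have "cauchy_solution f D x0 \<sigma> g"
        using g_cont D g0 unfolding cauchy_solution_def by blast
      then show False using False \<sigma> by (auto simp: A_def)
    qed
    have "(g \<longlongrightarrow> g \<sigma>) (at \<sigma> within {0..\<sigma>})"
      using g_cont \<open>0 < \<sigma>\<close> by (auto simp: continuous_on_def)
    then have lim: "(g \<longlongrightarrow> g \<sigma>) (at_left \<sigma>)"
      using \<open>0 < \<sigma>\<close> by (simp add: at_within_Icc_at_left)
    have "g t \<in> closure D" if "t \<in> {0<..<\<sigma>}" for t
      using g_D[of t] closure_subset[of D] that by auto
    then have "\<forall>\<^sub>F t in at_left \<sigma>. g t \<in> closure D"
      by (rule eventually_mono[OF eventually_at_left_real[OF \<open>0 < \<sigma>\<close>]])
    then have "g \<sigma> \<in> closure D"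
      using Lim_in_closed_set[OF closed_closure _ _ lim] by auto
    then have "g \<sigma> \<in> frontier D"
      using \<open>g \<sigma> \<notin> D\<close> open_domain by (simp add: frontier_def interior_open)
    then have "exits_through_boundary f D x0 \<sigma> g"
      using g_sol lim by (auto simp: exits_through_boundary_def)
    then show ?thesis using \<open>0 < \<sigma>\<close> \<sigma> by auto
  qed
qed

end


section \<open>Dynkin words and their brackets\<close>

text \<open>The letters of a Dynkin word, \<open>True\<close> standing for the first argument and \<open>False\<close> for the
  second one.\<close>

definition letters :: "(nat \<times> nat) list \<Rightarrow> bool list" where
  "letters w = concat (map (\<lambda>(p, q). replicate p True @ replicate q False) w)"

definition word_bracket :: "('g::zero \<Rightarrow> 'g \<Rightarrow> 'g) \<Rightarrow> bool list \<Rightarrow> 'g \<Rightarrow> 'g \<Rightarrow> 'g" where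
  "word_bracket br bs x y = nested_bracket br (map (\<lambda>b. if b then x else y) bs)"

abbreviation fst_degree :: "(nat \<times> nat) list \<Rightarrow> nat" where
  "fst_degree w \<equiv> sum_list (map fst w)"

abbreviation snd_degree :: "(nat \<times> nat) list \<Rightarrow> nat" where
  "snd_degree w \<equiv> sum_list (map snd w)"

lemma word_degree_eq: "word_degree w = fst_degree w + snd_degree w"
  by (induction w) (auto simp: word_degree_def)

lemma letters_simps:
  "letters [] = []"
  "letters ((p, q) # w) = replicate p True @ replicate q False @ letters w"
  by (simp_all add: letters_def)

lemma count_letters:
  "count_list (letters w) True = fst_degree w" "count_list (letters w) False = snd_degree w"
proof -
  have "count_list (replicate n b) c = (if b = c then n else 0)" for n b and c :: bool
    by (induction n) auto
  then show "count_list (letters w) True = fst_degree w" "count_list (letters w) False = snd_degree w"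
    by (induction w) (auto simp: letters_simps)
qed

lemma length_letters: "length (letters w) = word_degree w"
  by (induction w) (auto simp: letters_simps word_degree_def)

text \<open>Each summand becomes a fixed pattern of letters evaluated at \<open>x\<close> and
  \<open>y\<close>, so that homogeneity and differentiability can be proved by induction on the
  pattern.\<close>

lemma bch_eq_word_brackets:
  "bch N br x y = (\<Sum>w\<in>dynkin_words N. dynkin_coeff w *\<^sub>R word_bracket br (letters w) x y)"
proof -
  have "concat (map (\<lambda>(p, q). replicate p x @ replicate q y) w) =
      map (\<lambda>b. if b then x else y) (letters w)" for w
    by (induction w) (auto simp: letters_simps)
  then show ?thesis by (simp add: bch_def word_bracket_def)
qed

lemma word_bracket_simps:
  "word_bracket br [] x y = 0"
  "word_bracket br [b] x y = (if b then x else y)"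
  "word_bracket br (b # c # bs) x y = br (if b then x else y) (word_bracket br (c # bs) x y)"
  by (simp_all add: word_bracket_def)

text \<open>Each letter contributes one scalar factor by bilinearity. This makes the group law
  polynomial along lines and lets words be sorted by bidegree.\<close>

lemma word_bracket_scaleR:
  assumes "bilinear br"
  shows "word_bracket br bs (s *\<^sub>R x) (t *\<^sub>R y) =
    (s ^ count_list bs True * t ^ count_list bs False) *\<^sub>R word_bracket br bs x y"
proof (induction bs rule: induct_list012)
  case (3 b c bs)
  show ?case
    unfolding word_bracket_simps "3.IH"(2)
    by (cases b) (simp_all add: bilinear_lmul[OF assms] bilinear_rmul[OF assms] ac_simps)
qed (auto simp: word_bracket_simps)

text \<open>The innermost bracket is one of the four brackets assumed to vanish, and the outer
  brackets preserve zero.\<close>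

lemma word_bracket_commuting:
  assumes "bilinear br" and "br x x = 0" "br y y = 0" "br x y = 0" "br y x = 0"
    and "2 \<le> length bs"
  shows "word_bracket br bs x y = 0"
  using \<open>2 \<le> length bs\<close>
proof (induction bs rule: induct_list012)
  case (3 b c bs)
  then show ?case
    using assms by (cases bs) (auto simp: word_bracket_simps bilinear_rzero)
qed auto

text \<open>Iterated product rule for the bilinear bracket. Differentiability is joint in both
  arguments because later both factors of a product move.\<close>

lemma word_bracket_differentiable:
  fixes br :: "'g::euclidean_space \<Rightarrow> 'g \<Rightarrow> 'g"
  assumes "bilinear br"
  shows "(\<lambda>z. word_bracket br bs (fst z) (snd z)) differentiable (at z)"
proof (induction bs rule: induct_list012)
  case (2 b)
  then show ?case
    by (cases b) (auto simp: word_bracket_simps intro!: bounded_linear_imp_differentiable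
        bounded_linear_fst bounded_linear_snd)
next
  case (3 b c bs)
  obtain D where D: "((\<lambda>z. word_bracket br (c # bs) (fst z) (snd z)) has_derivative D) (at z)"
    using "3.IH"(2) by (auto simp: differentiable_def)
  have bb: "bounded_bilinear br"
    using assms bilinear_conv_bounded_bilinear by blast
  have "((\<lambda>z. if b then fst z else snd z) has_derivative (\<lambda>z. if b then fst z else snd z)) (at z)"
    by (cases b) (auto intro!: derivative_eq_intros)
  from bounded_bilinear.FDERIV[OF bb this D] show ?case
    by (auto simp: word_bracket_simps differentiable_def)
qed (simp add: word_bracket_simps)

lemma length_le_word_degree:
  "\<forall>(p, q)\<in>set w. 0 < p + q \<Longrightarrow> length w \<le> word_degree w"
  by (induction w) (auto simp: word_degree_def)

lemma dynkin_words_degree_1: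
  assumes "1 \<le> N"
  shows "{w \<in> dynkin_words N. word_degree w = 1} = {[(1, 0)], [(0, 1)]}"
proof -
  have "w = [(1, 0)] \<or> w = [(0, 1)]"
    if "w \<noteq> []" "\<forall>(p, q)\<in>set w. 0 < p + q" "word_degree w = 1" for w
  proof -
    obtain p q v where w: "w = (p, q) # v" using \<open>w \<noteq> []\<close> by (cases w) auto
    then have "v = []" using length_le_word_degree[OF that(2)] that(3) by simp
    then show ?thesis using w that by (auto simp: word_degree_def)
  qed
  then show ?thesis using assms by (auto simp: dynkin_words_def word_degree_def)
qed

text \<open>These words carry the terms of the group law linear in each factor, which determine the
  first derivative of a left-invariant field at the identity.\<close>

lemma dynkin_words_bidegree_1_1:
  assumes "2 \<le> N"
  shows "{w \<in> dynkin_words N. fst_degree w = 1 \<and> snd_degree w = 1} =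
    {[(1, 1)], [(1, 0), (0, 1)], [(0, 1), (1, 0)]}"
proof -
  have "w = [(1, 1)] \<or> w = [(1, 0), (0, 1)] \<or> w = [(0, 1), (1, 0)]"
    if w: "w \<noteq> []" "\<forall>(p, q)\<in>set w. 0 < p + q" and deg: "fst_degree w = 1" "snd_degree w = 1" for w
  proof -
    have len: "length w \<le> 2" using length_le_word_degree[OF w(2)] deg by (simp add: word_degree_eq)
    show ?thesis
    proof (cases w)
      case (Cons z v)
      obtain p q where z: "z = (p, q)" by (cases z)
      show ?thesis
      proof (cases v)
        case Nil
        then show ?thesis using Cons z deg by simp
      next
        case (Cons z' v')
        obtain p' q' where z': "z' = (p', q')" by (cases z')
        have "v' = []" using len \<open>w = z # v\<close> Cons by simp
        then have "p + p' = 1" "q + q' = 1" "0 < p + q" "0 < p' + q'"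
          using deg w \<open>w = z # v\<close> Cons z z' by auto
        then have "(p, q, p', q') = (1, 0, 0, 1) \<or> (p, q, p', q') = (0, 1, 1, 0)"
          by (cases p; cases q; auto)
        then show ?thesis using \<open>w = z # v\<close> Cons z z' \<open>v' = []\<close> by auto
      qed
    qed (use w in simp)
  qed
  then show ?thesis using assms by (auto simp: dynkin_words_def word_degree_def)
qed

section \<open>Derivatives of polynomial curves and directional derivatives\<close>

lemma power_has_real_derivative_at_0:
  "((\<lambda>t::real. t ^ n) has_real_derivative (if n = 1 then 1 else 0)) (at 0)"
proof -
  have "((\<lambda>t::real. t ^ n) has_real_derivative of_nat n * 0 ^ (n - Suc 0)) (at 0)"
    using DERIV_pow[of n 0 UNIV] by simp
  \<comment> \<open>For \<open>n = 0\<close> the factor \<open>of_nat n\<close> vanishes; for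
    \<open>n = 1\<close> the value comes from \<open>0 ^ 0 = 1\<close>.\<close>
  moreover have "of_nat n * 0 ^ (n - Suc 0) = (if n = 1 then 1 else 0 :: real)"
    by (cases n) auto
  ultimately show ?thesis by simp
qed

lemma sum_powers_has_vector_derivative_at_0:
  fixes h :: "'b \<Rightarrow> 'a::real_normed_vector"
  assumes "finite W"
  shows "((\<lambda>t. \<Sum>w\<in>W. t ^ n w *\<^sub>R h w) has_vector_derivative (\<Sum>w\<in>{w\<in>W. n w = 1}. h w)) (at 0)"
proof -
  have "((\<lambda>t. \<Sum>w\<in>W. t ^ n w *\<^sub>R h w) has_vector_derivative
      (\<Sum>w\<in>W. 0 ^ n w *\<^sub>R 0 + (if n w = 1 then 1 else 0) *\<^sub>R h w)) (at 0)"
    by (intro has_vector_derivative_sum has_vector_derivative_scaleR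
        power_has_real_derivative_at_0 has_vector_derivative_const)
  moreover have "(\<Sum>w\<in>W. 0 ^ n w *\<^sub>R 0 + (if n w = 1 then 1 else 0) *\<^sub>R h w) =
      (\<Sum>w\<in>{w\<in>W. n w = 1}. h w)"
    unfolding sum.inter_filter[OF assms] by (rule sum.cong) auto
  ultimately show ?thesis by simp
qed

text \<open>By the chain rule along a line, a Frechet derivative can be read off from a polynomial
  in one real variable.\<close>

lemma frechet_derivative_directional:
  assumes f: "f differentiable (at x)"
    and "((\<lambda>t. f (x + t *\<^sub>R v)) has_vector_derivative D) (at 0)"
  shows "frechet_derivative f (at x) v = D"
proof -
  have f': "(f has_derivative frechet_derivative f (at x)) (at x)"
    using f frechet_derivative_works by blast
  have "((\<lambda>t. x + t *\<^sub>R v) has_derivative (\<lambda>t. t *\<^sub>R v)) (at 0)"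
    by (auto intro!: derivative_eq_intros)
  then have "((\<lambda>t. f (x + t *\<^sub>R v)) has_derivative (\<lambda>t. frechet_derivative f (at x) (t *\<^sub>R v))) (at 0)"
    by (rule has_derivative_compose) (use f' in simp)
  then have "((\<lambda>t. f (x + t *\<^sub>R v)) has_vector_derivative frechet_derivative f (at x) v) (at 0)"
    by (simp add: has_vector_derivative_def linear_scale[OF has_derivative_linear[OF f']])
  then show ?thesis using assms(2) vector_derivative_unique_at by blast
qed

section \<open>Left-invariant fields on homogeneous groups\<close>

context homogeneous_group
begin

interpretation mul: group mul 0 uminus
  by (rule group_law)

lemma mul_0_right: "mul x 0 = x"
  by (rule mul.right_neutral)

lemma mul_cancel_right: "mul (mul x (- u)) u = x"
  by (simp add: mul.assoc mul.left_inverse mul_0_right)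

lemma bracket_antisym: "br y x = - br x y"
proof -
  have "br (x + y) (x + y) = br x x + br x y + (br y x + br y y)"
    by (simp add: bilinear_ladd[OF bilinear_bracket] bilinear_radd[OF bilinear_bracket])
  then show ?thesis by (simp add: bracket_self eq_neg_iff_add_eq_0 add.commute)
qed

text \<open>Without layers every vector would be an empty sum, whereas a Euclidean space has a
  nonzero basis vector.\<close>

lemma top_layer_pos: "1 \<le> \<iota>"
proof (rule ccontr)
  assume "\<not> 1 \<le> \<iota>"
  then have "x = 0" for x :: 'g using layers_span[of x] by simp
  then show False using nonempty_Basis nonzero_Basis by blast
qed

text \<open>Independence of the layers is applied to \<open>0 = x + (- x)\<close>, with
  \<open>x\<close> placed in degree \<open>1\<close> and \<open>- x\<close> in degree
  \<open>2\<close>.\<close>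

lemma layers_1_2_disjoint:
  assumes "2 \<le> \<iota>" "x \<in> H 1" "x \<in> H 2"
  shows "x = 0"
proof -
  let ?u = "\<lambda>j::nat. if j = 1 then x else if j = 2 then - x else 0"
  have "\<forall>j\<in>{1..\<iota>}. ?u j \<in> H j"
    using assms by (auto intro: subspace_neg[OF subspace_layer] subspace_0[OF subspace_layer])
  moreover have "(\<Sum>j=1..\<iota>. ?u j) = (\<Sum>j\<in>{1, 2}. ?u j)"
    using assms by (intro sum.mono_neutral_right) auto
  ultimately have "?u 1 = 0"
    using layers_independent[of ?u] assms by fastforce
  then show ?thesis by simp
qed

text \<open>All words of degree at least two have vanishing brackets; the two words of degree one
  contribute \<open>x\<close> and \<open>y\<close>.\<close>

lemma mul_commuting:
  assumes "br x y = 0"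
  shows "mul x y = x + y"
proof -
  have "br y x = 0" using assms bracket_antisym[of y x] by simp
  have "mul x y = (\<Sum>w\<in>dynkin_words \<iota>. dynkin_coeff w *\<^sub>R word_bracket br (letters w) x y)"
    by (simp add: mul_bch bch_eq_word_brackets)
  also have "\<dots> = (\<Sum>w\<in>{w\<in>dynkin_words \<iota>. word_degree w = 1}.
      dynkin_coeff w *\<^sub>R word_bracket br (letters w) x y)"
  proof (intro sum.mono_neutral_right finite_dynkin_words ballI)
    fix w assume "w \<in> dynkin_words \<iota> - {w \<in> dynkin_words \<iota>. word_degree w = 1}"
    then have w: "w \<in> dynkin_words \<iota>" "word_degree w \<noteq> 1" by auto
    then have "0 < length w" "length w \<le> word_degree w"
      by (auto simp: dynkin_words_def length_le_word_degree)
    then have "2 \<le> length (letters w)" using w(2) unfolding length_letters by linarith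
    then show "dynkin_coeff w *\<^sub>R word_bracket br (letters w) x y = 0"
      using word_bracket_commuting[OF bilinear_bracket] bracket_self assms \<open>br y x = 0\<close> by simp
  qed auto
  also have "\<dots> = x + y"
    unfolding dynkin_words_degree_1[OF top_layer_pos]
    by (simp add: dynkin_coeff_def word_degree_def letters_simps word_bracket_simps)
  finally show ?thesis .
qed

lemma mul_pair_differentiable: "(\<lambda>z. mul (fst z) (snd z)) differentiable (at z)"
  unfolding mul_bch bch_eq_word_brackets
  by (intro differentiable_sum finite_dynkin_words ballI differentiable_scaleR
      differentiable_const word_bracket_differentiable bilinear_bracket)

lemma mul_differentiable: "mul x differentiable (at y)"
proof -
  have "(\<lambda>y. (x, y)) differentiable (at y)"
    by (auto simp: differentiable_def intro!: derivative_eq_intros exI)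
  from differentiable_chain_at[OF this mul_pair_differentiable]
  show ?thesis by (simp add: o_def)
qed

lemma continuous_mul: "continuous_on A (mul x)"
  by (intro differentiable_imp_continuous_on differentiable_at_imp_differentiable_on
      mul_differentiable)

lemma linear_frechet_derivative_mul: "linear (frechet_derivative (mul x) (at y))"
  by (intro linear_frechet_derivative mul_differentiable)

section \<open>Left-invariant fields as polynomial maps, and their brackets at the identity\<close>

lemma left_invariant_eq:
  assumes "left_invariant mul X"
  shows "X x = frechet_derivative (mul x) (at 0) (X 0)"
  using assms unfolding left_invariant_def by (metis mul_0_right)

text \<open>The derivative of \<open>mul x (t *\<^sub>R X 0)\<close> at \<open>t = 0\<close> retains
  exactly the words that are linear in the second argument.\<close>

lemma left_invariant_expansion:
  assumes "left_invariant mul X"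
  shows "X x = (\<Sum>w\<in>{w\<in>dynkin_words \<iota>. snd_degree w = 1}.
    dynkin_coeff w *\<^sub>R word_bracket br (letters w) x (X 0))"
  unfolding left_invariant_eq[OF assms, of x]
proof (rule frechet_derivative_directional[OF mul_differentiable])
  have "mul x (0 + t *\<^sub>R X 0) = (\<Sum>w\<in>dynkin_words \<iota>.
      t ^ snd_degree w *\<^sub>R dynkin_coeff w *\<^sub>R word_bracket br (letters w) x (X 0))" for t
    using word_bracket_scaleR[OF bilinear_bracket, of _ 1 x t "X 0"]
    by (simp add: mul_bch bch_eq_word_brackets count_letters ac_simps)
  then show "((\<lambda>t. mul x (0 + t *\<^sub>R X 0)) has_vector_derivative
      (\<Sum>w\<in>{w\<in>dynkin_words \<iota>. snd_degree w = 1}.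
        dynkin_coeff w *\<^sub>R word_bracket br (letters w) x (X 0))) (at 0)"
    by (simp only:) (rule sum_powers_has_vector_derivative_at_0[OF finite_dynkin_words])
qed

text \<open>Left invariance as defined asks for no regularity; the polynomial expansion supplies
  it.\<close>

lemma left_invariant_differentiable:
  assumes "left_invariant mul X"
  shows "X differentiable (at x)"
proof -
  have "(\<lambda>x. word_bracket br bs x (X 0)) differentiable (at x)" for bs
  proof -
    have "(\<lambda>x. (x, X 0)) differentiable (at x)"
      by (auto simp: differentiable_def intro!: derivative_eq_intros exI)
    from differentiable_chain_at[OF this word_bracket_differentiable[OF bilinear_bracket, of bs]]
    show ?thesis by (simp add: o_def)
  qed
  then have diff: "(\<lambda>x. \<Sum>w\<in>{w\<in>dynkin_words \<iota>. snd_degree w = 1}.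
      dynkin_coeff w *\<^sub>R word_bracket br (letters w) x (X 0)) differentiable (at x)"
    using finite_dynkin_words[of \<iota>]
    by (intro differentiable_sum ballI differentiable_scaleR differentiable_const) auto
  have "X = (\<lambda>x. \<Sum>w\<in>{w\<in>dynkin_words \<iota>. snd_degree w = 1}.
      dynkin_coeff w *\<^sub>R word_bracket br (letters w) x (X 0))"
    using left_invariant_expansion[OF assms] by (rule ext)
  then show ?thesis by (rule ssubst) (rule diff)
qed

text \<open>Differentiating the expansion at the identity leaves the words of bidegree
  \<open>(1, 1)\<close>.\<close>

lemma frechet_derivative_left_invariant_0:
  assumes X: "left_invariant mul X" and "2 \<le> \<iota>"
  shows "frechet_derivative X (at 0) z = (1 / 2) *\<^sub>R br z (X 0)"
proof (rule frechet_derivative_directional[OF left_invariant_differentiable[OF X]])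
  let ?W = "{w\<in>dynkin_words \<iota>. snd_degree w = 1}"
  let ?h = "\<lambda>w. dynkin_coeff w *\<^sub>R word_bracket br (letters w) z (X 0)"
  have "X (0 + t *\<^sub>R z) = (\<Sum>w\<in>?W. t ^ fst_degree w *\<^sub>R ?h w)" for t
    unfolding left_invariant_expansion[OF X, of "0 + t *\<^sub>R z"]
    using word_bracket_scaleR[OF bilinear_bracket, of _ t z 1 "X 0"]
    by (simp add: count_letters ac_simps)
  moreover have "finite ?W" using finite_dynkin_words by simp
  ultimately have "((\<lambda>t. X (0 + t *\<^sub>R z)) has_vector_derivative
      (\<Sum>w\<in>{w\<in>?W. fst_degree w = 1}. ?h w)) (at 0)"
    by (simp only:) (rule sum_powers_has_vector_derivative_at_0)
  moreover have "(\<Sum>w\<in>{w\<in>?W. fst_degree w = 1}. ?h w) = (1 / 2) *\<^sub>R br z (X 0)"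
  proof -
    have "{w\<in>?W. fst_degree w = 1} = {w \<in> dynkin_words \<iota>. fst_degree w = 1 \<and> snd_degree w = 1}"
      by auto
    \<comment> \<open>The coefficients \<open>1/2\<close>, \<open>-1/4\<close>, \<open>-1/4\<close>
      multiply \<open>br z (X 0)\<close>, \<open>br z (X 0)\<close> and \<open>br (X 0) z\<close>;
      by antisymmetry the last two terms cancel.\<close>
    then show ?thesis
      unfolding dynkin_words_bidegree_1_1[OF \<open>2 \<le> \<iota>\<close>]
      by (simp add: dynkin_coeff_def word_degree_def letters_simps word_bracket_simps
          bracket_antisym[of "X 0" z])
  qed
  ultimately show "((\<lambda>t. X (0 + t *\<^sub>R z)) has_vector_derivative (1 / 2) *\<^sub>R br z (X 0)) (at 0)"
    by simp
qed

text \<open>The two derivatives contribute \<open>1/2\<close> of \<open>br (X 0) (Z 0)\<close> and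
  of \<open>br (Z 0) (X 0)\<close>; antisymmetry turns their difference into the full bracket.
  Involutivity of fields thereby becomes a condition on the algebra.\<close>

lemma field_bracket_0:
  assumes "left_invariant mul X" "left_invariant mul Z" "2 \<le> \<iota>"
  shows "field_bracket X Z 0 = br (X 0) (Z 0)"
  unfolding field_bracket_def
    frechet_derivative_left_invariant_0[OF assms(1,3)]
    frechet_derivative_left_invariant_0[OF assms(2,3)]
  by (subst bracket_antisym[of "Z 0"]) (simp add: scaleR_add_left[symmetric])

text \<open>The value lies both in \<open>H 2\<close>, by the grading, and in \<open>H 1\<close>, by
  involutivity. If there is only one layer, the grading alone forces it to vanish.\<close>

lemma involutive_bracket_0:
  assumes S: "S \<subseteq> layer_fields H mul 1" "involutive_subalgebra S" and XZ: "X \<in> S" "Z \<in> S"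
  shows "br (X 0) (Z 0) = 0"
proof -
  have XZ': "left_invariant mul X" "X 0 \<in> H 1" "left_invariant mul Z" "Z 0 \<in> H 1"
    using assms by (auto simp: layer_fields_def)
  have 2: "br (X 0) (Z 0) \<in> H 2"
    using bracket_layers[of 1 1 "X 0" "Z 0"] XZ' by (simp add: numeral_2_eq_2)
  show ?thesis
  proof (cases "2 \<le> \<iota>")
    case True
    have "field_bracket X Z \<in> S" using S(2) XZ by (simp add: involutive_subalgebra_def)
    then have "field_bracket X Z 0 \<in> H 1" using S(1) by (auto simp: layer_fields_def)
    then show ?thesis
      using layers_1_2_disjoint[OF True _ 2] field_bracket_0 XZ' True by simp
  next
    case False
    then show ?thesis using 2 layer_trivial[of 2] by simp
  qed
qed

text \<open>As \<open>dilation\<close> is a definite description, its value is available only after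
  existence and uniqueness of the linear map. Both follow from the layer components
  \<open>u x j\<close>, which are linear in \<open>x\<close> because the decomposition is
  unique.\<close>

lemma dilation_layer_1:
  assumes "x \<in> H 1"
  shows "dilation H \<iota> r x = r *\<^sub>R x"
proof -
  define P where "P D \<longleftrightarrow> linear D \<and> (\<forall>j\<in>{1..\<iota>}. \<forall>x\<in>H j. D x = r ^ j *\<^sub>R x)" for D
  obtain u where u: "\<And>x j. j \<in> {1..\<iota>} \<Longrightarrow> u x j \<in> H j" "\<And>x. x = (\<Sum>j=1..\<iota>. u x j)"
    using layers_span by metis
  have u_sum: "sum (u x) {Suc 0..\<iota>} = x" for x
    using u(2)[of x, symmetric] by simp
  have unique: "u x j = v j"
    if v: "\<And>j. j \<in> {1..\<iota>} \<Longrightarrow> v j \<in> H j" "x = (\<Sum>j=1..\<iota>. v j)" and j: "j \<in> {1..\<iota>}" for x v j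
  proof -
    have "(\<Sum>j=1..\<iota>. u x j - v j) = 0" using u(2)[of x, symmetric] v(2)[symmetric] by (simp add: sum_subtractf)
    then have "\<forall>j\<in>{1..\<iota>}. u x j - v j = 0"
      by (rule layers_independent[rotated])
        (use u(1) v(1) in \<open>auto intro: subspace_diff[OF subspace_layer]\<close>)
    then show ?thesis using j by simp
  qed
  have add: "u (x + y) j = u x j + u y j" if "j \<in> {1..\<iota>}" for x y j
    using that u(1) subspace_layer
    by (intro unique) (auto simp: subspace_add sum.distrib u_sum)
  have scale: "u (c *\<^sub>R x) j = c *\<^sub>R u x j" if "j \<in> {1..\<iota>}" for c x j
    using that u(1) subspace_layer
    by (intro unique) (auto simp: subspace_scale scaleR_sum_right[symmetric] u_sum)
  have layer: "u x j = (if j = i then x else 0)" if "i \<in> {1..\<iota>}" "x \<in> H i" "j \<in> {1..\<iota>}" for x i j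
    using that subspace_layer
    by (intro unique[where v = "\<lambda>j. if j = i then x else 0"]) (auto simp: subspace_0)
  let ?D = "\<lambda>x. \<Sum>j=1..\<iota>. r ^ j *\<^sub>R u x j"
  have "P ?D"
    unfolding P_def
  proof (intro conjI ballI)
    show "linear ?D"
      by (rule linearI) (auto simp: add scale scaleR_add_right sum.distrib scaleR_sum_right
          mult.commute intro!: sum.cong)
    fix i x assume i: "i \<in> {1..\<iota>}" "x \<in> H i"
    have "?D x = (\<Sum>j=1..\<iota>. if j = i then r ^ i *\<^sub>R x else 0)"
      by (rule sum.cong) (auto simp: layer[OF i])
    then show "?D x = r ^ i *\<^sub>R x" using i by simp
  qed
  moreover have "D = ?D" if "P D" for D
  proof
    fix x
    have "D x = D (\<Sum>j=1..\<iota>. u x j)" by (rule arg_cong[OF u(2)])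
    also have "\<dots> = (\<Sum>j=1..\<iota>. D (u x j))" using that by (simp add: P_def linear_sum)
    also have "\<dots> = ?D x" using that u(1) by (intro sum.cong) (auto simp: P_def)
    finally show "D x = ?D x" .
  qed
  ultimately have "P (dilation H \<iota> r)"
    unfolding dilation_def P_def[symmetric] by (rule theI)
  then have "dilation H \<iota> r x = r ^ 1 *\<^sub>R x"
    using assms top_layer_pos unfolding P_def by (meson atLeastAtMost_iff order_refl)
  then show ?thesis by simp
qed

end

section \<open>Cosets of an abelian horizontal subspace\<close>

locale horizontal_abelian_subspace = homogeneous_group H \<iota> br mul
  for H :: "nat \<Rightarrow> 'g::euclidean_space set" and \<iota> br mul +
  fixes V :: "'g set"
  assumes subspace_V: "subspace V"
    and V_horizontal: "V \<subseteq> H 1"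
    and V_abelian: "\<And>x y. \<lbrakk>x \<in> V; y \<in> V\<rbrakk> \<Longrightarrow> br x y = 0"
begin

lemma mul_V: "\<lbrakk>x \<in> V; y \<in> V\<rbrakk> \<Longrightarrow> mul x y = x + y"
  by (simp add: mul_commuting V_abelian)

text \<open>For \<open>u \<in> V\<close> the curve \<open>mul u (t *\<^sub>R X 0)\<close> is the
  straight line \<open>u + t *\<^sub>R X 0\<close>, so left translation by \<open>u\<close> does not
  change the direction \<open>X 0\<close>.\<close>

lemma left_invariant_V:
  assumes "left_invariant mul X" "X 0 \<in> V" "u \<in> V"
  shows "X u = X 0"
  unfolding left_invariant_eq[OF assms(1), of u]
proof (rule frechet_derivative_directional[OF mul_differentiable])
  have "mul u (0 + t *\<^sub>R X 0) = u + t *\<^sub>R X 0" for t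
    using assms subspace_V by (simp add: mul_V subspace_scale)
  then show "((\<lambda>t. mul u (0 + t *\<^sub>R X 0)) has_vector_derivative X 0) (at 0)"
    by (auto intro!: derivative_eq_intros)
qed

text \<open>Differentiate \<open>(x (s v)) (- u) = x (s v - u)\<close> at \<open>s = 0\<close>.\<close>

lemma frechet_derivative_mul_translate:
  assumes "v \<in> V" "u \<in> V"
  shows "frechet_derivative (\<lambda>z. mul (fst z) (snd z)) (at (x, - u))
      (frechet_derivative (mul x) (at 0) v, - v) = 0"
proof -
  let ?M = "\<lambda>z. mul (fst z) (snd z)"
  let ?w = "frechet_derivative (mul x) (at 0) v"
  have M: "(?M has_derivative frechet_derivative ?M (at z)) (at z)" for z
    using mul_pair_differentiable frechet_derivative_works by blast
  have "(mul x has_derivative frechet_derivative (mul x) (at 0)) (at 0)"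
    using mul_differentiable frechet_derivative_works by blast
  then have "(mul x has_derivative frechet_derivative (mul x) (at 0)) (at (0 *\<^sub>R v))" by simp
  moreover have "((\<lambda>s. s *\<^sub>R v) has_derivative (\<lambda>s. s *\<^sub>R v)) (at 0)"
    by (auto intro!: derivative_eq_intros)
  ultimately have "((\<lambda>s. mul x (s *\<^sub>R v)) has_derivative
      (\<lambda>s. frechet_derivative (mul x) (at 0) (s *\<^sub>R v))) (at 0)"
    using has_derivative_compose by blast
  then have "((\<lambda>s. mul x (s *\<^sub>R v)) has_derivative (\<lambda>s. s *\<^sub>R ?w)) (at 0)"
    by (simp add: linear_scale[OF linear_frechet_derivative_mul])
  moreover have "((\<lambda>s. - u - s *\<^sub>R v) has_derivative (\<lambda>s. s *\<^sub>R (- v))) (at 0)"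
    by (auto intro!: derivative_eq_intros)
  ultimately have pair: "((\<lambda>s. (mul x (s *\<^sub>R v), - u - s *\<^sub>R v)) has_derivative
      (\<lambda>s. (s *\<^sub>R ?w, s *\<^sub>R (- v)))) (at 0)"
    by (rule has_derivative_Pair)
  have "((\<lambda>s. ?M (mul x (s *\<^sub>R v), - u - s *\<^sub>R v)) has_derivative
      (\<lambda>s. frechet_derivative ?M (at (x, - u)) (s *\<^sub>R ?w, s *\<^sub>R (- v)))) (at 0)"
    using has_derivative_compose[OF pair, of ?M] M by (simp add: mul_0_right)
  \<comment> \<open>The motion of the second factor compensates that of the first:
    \<open>s *\<^sub>R v\<close> and \<open>- u - s *\<^sub>R v\<close> lie in \<open>V\<close>,
    where the product is the sum, so \<open>s\<close> cancels.\<close>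
  moreover have "?M (mul x (s *\<^sub>R v), - u - s *\<^sub>R v) = mul x (- u)" for s
  proof -
    have "mul (mul x (s *\<^sub>R v)) (- u - s *\<^sub>R v) = mul x (mul (s *\<^sub>R v) (- u - s *\<^sub>R v))"
      using group.axioms(1)[OF group_law] semigroup.assoc by fastforce
    also have "mul (s *\<^sub>R v) (- u - s *\<^sub>R v) = - u"
      using assms subspace_V by (subst mul_V) (auto simp: subspace_scale subspace_neg subspace_diff)
    finally show ?thesis by simp
  qed
  ultimately have "((\<lambda>s::real. mul x (- u)) has_derivative
      (\<lambda>s. frechet_derivative ?M (at (x, - u)) (s *\<^sub>R ?w, s *\<^sub>R (- v)))) (at 0)"
    by simp
  from has_derivative_unique[OF this has_derivative_const]
  have "frechet_derivative ?M (at (x, - u)) (1 *\<^sub>R ?w, 1 *\<^sub>R (- v)) = 0" by metis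
  then show ?thesis by simp
qed

text \<open>Here \<open>v\<close> is the velocity of \<open>\<gamma>\<close> pulled back to the
  identity. The product \<open>mul (\<gamma> t) (- u t)\<close> has derivative zero, hence keeps its
  initial value \<open>\<gamma> 0\<close>, and multiplying by \<open>u t\<close> on the right gives
  the claim.\<close>

lemma curve_in_coset:
  assumes \<gamma>: "\<And>t. t \<in> {0..\<tau>} \<Longrightarrow>
      (\<gamma> has_vector_derivative frechet_derivative (mul (\<gamma> t)) (at 0) (v t)) (at t within {0..\<tau>})"
    and u: "\<And>t. t \<in> {0..\<tau>} \<Longrightarrow> (u has_vector_derivative v t) (at t within {0..\<tau>})"
    and V: "\<And>t. t \<in> {0..\<tau>} \<Longrightarrow> u t \<in> V" "\<And>t. t \<in> {0..\<tau>} \<Longrightarrow> v t \<in> V"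
    and "u 0 = 0" and t: "t \<in> {0..\<tau>}"
  shows "\<gamma> t = mul (\<gamma> 0) (u t)"
proof -
  let ?M = "\<lambda>z. mul (fst z) (snd z)"
  have "((\<lambda>t. ?M (\<gamma> t, - u t)) has_vector_derivative 0) (at t within {0..\<tau>})"
    if t: "t \<in> {0..\<tau>}" for t
  proof -
    have M: "(?M has_derivative frechet_derivative ?M (at z)) (at z)" for z
      using mul_pair_differentiable frechet_derivative_works by blast
    have "((\<lambda>t. (\<gamma> t, - u t)) has_derivative
        (\<lambda>h. (h *\<^sub>R frechet_derivative (mul (\<gamma> t)) (at 0) (v t), - (h *\<^sub>R v t)))) (at t within {0..\<tau>})"
      using \<gamma>[OF t] u[OF t] unfolding has_vector_derivative_def
      by (intro has_derivative_Pair has_derivative_minus)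
    from has_derivative_compose[OF this M]
    have "((\<lambda>t. ?M (\<gamma> t, - u t)) has_derivative (\<lambda>h. frechet_derivative ?M (at (\<gamma> t, - u t))
        (h *\<^sub>R (frechet_derivative (mul (\<gamma> t)) (at 0) (v t), - v t)))) (at t within {0..\<tau>})"
      by simp
    then show ?thesis
      unfolding has_vector_derivative_def
      by (simp only: linear_scale[OF has_derivative_linear[OF M]]
          frechet_derivative_mul_translate[OF V(2)[OF t] V(1)[OF t]])
  qed
  then obtain c where c: "\<And>t. t \<in> {0..\<tau>} \<Longrightarrow> mul (\<gamma> t) (- u t) = c"
    using has_vector_derivative_zero_constant[of "{0..\<tau>}" "\<lambda>t. ?M (\<gamma> t, - u t)"] by auto
  have "c = \<gamma> 0" using c[of 0] t \<open>u 0 = 0\<close> by (simp add: mul_0_right)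
  then show ?thesis using c[OF t] mul_cancel_right[of "\<gamma> t" "u t"] by simp
qed

text \<open>On \<open>V\<close> the group operation is addition, so \<open>d 0\<close> is subadditive and homogeneous there.\<close>

lemma homogeneous_distance_le_norm:
  assumes d: "homogeneous_distance H \<iota> mul d"
  obtains C where "0 \<le> C"
    "\<And>x u v. \<lbrakk>u \<in> V; v \<in> V\<rbrakk> \<Longrightarrow> d (mul x u) (mul x v) \<le> C * norm (u - v)"
proof -
  interpret Metric_space UNIV d using d by (simp add: homogeneous_distance_def)
  have inv: "d (mul z x) (mul z y) = d x y" for x y z
    using d by (simp add: homogeneous_distance_def)
  have pos: "d 0 (r *\<^sub>R x) = r * d 0 x" if "0 < r" "x \<in> V" for r x
  proof -
    have "d (dilation H \<iota> r 0) (dilation H \<iota> r x) = r * d 0 x"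
      using d \<open>0 < r\<close> by (simp add: homogeneous_distance_def)
    moreover have "0 \<in> H 1" "x \<in> H 1"
      using that V_horizontal subspace_layer[of 1] by (auto simp: subspace_0)
    ultimately show ?thesis by (simp add: dilation_layer_1)
  qed
  have diff: "d u v = d 0 (v - u)" if "u \<in> V" "v \<in> V" for u v
    using inv[of u 0 "v - u"] that subspace_V by (simp add: mul_0_right mul_V subspace_diff)
  have neg: "d 0 (- u) = d 0 u" if "u \<in> V" for u
    using diff[of u 0] that subspace_V commute[of u 0] by (simp add: subspace_0)
  \<comment> \<open>Dilations give the case of positive \<open>r\<close> only; negative
    \<open>r\<close> reduces to it by \<open>neg\<close>, which rests on left invariance and
    symmetry of \<open>d\<close>.\<close>
  have scale: "d 0 (r *\<^sub>R u) = \<bar>r\<bar> * d 0 u" if "u \<in> V" for r u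
  proof (cases r "0::real" rule: linorder_cases)
    case less
    then show ?thesis
      using pos[of "- r" u] neg[of "r *\<^sub>R u"] that subspace_V by (simp add: subspace_scale)
  qed (use pos that in auto)
  have add: "d 0 (u + v) \<le> d 0 u + d 0 v" if "u \<in> V" "v \<in> V" for u v
    using triangle[of 0 u "u + v"] diff[of u "u + v"] that subspace_V by (simp add: subspace_add)
  have sum: "(\<Sum>b\<in>B. c b *\<^sub>R b) \<in> V \<and> d 0 (\<Sum>b\<in>B. c b *\<^sub>R b) \<le> (\<Sum>b\<in>B. \<bar>c b\<bar> * d 0 b)"
    if "finite B" "B \<subseteq> V" for B and c :: "'g \<Rightarrow> real"
    using that
  proof (induction B)
    case (insert b B)
    then show ?case
      using add[of "c b *\<^sub>R b" "\<Sum>b\<in>B. c b *\<^sub>R b"] scale[of b "c b"] subspace_V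
      by (auto simp: subspace_add subspace_scale)
  qed (use subspace_V in \<open>auto simp: subspace_0\<close>)
  obtain B where B: "B \<subseteq> V" "pairwise orthogonal B" "\<And>x. x \<in> B \<Longrightarrow> norm x = 1"
      "independent B" "span B = V"
    using orthonormal_basis_subspace[OF subspace_V] by metis
  then have "finite B" by (simp add: independent_imp_finite)
  \<comment> \<open>In an orthonormal basis of \<open>V\<close> every coordinate of \<open>u\<close>
    is at most \<open>norm u\<close>, so summing the values \<open>d 0 b\<close> gives the
    constant.\<close>
  define C where "C = (\<Sum>b\<in>B. d 0 b)"
  have bound: "d 0 u \<le> C * norm u" if "u \<in> V" for u
  proof -
    have "d 0 u = d 0 (\<Sum>b\<in>B. (u \<bullet> b) *\<^sub>R b)"
      using orthonormal_basis_expand[OF B(2,3) _ \<open>finite B\<close>, of u] that B(5) by simp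
    also have "\<dots> \<le> (\<Sum>b\<in>B. \<bar>u \<bullet> b\<bar> * d 0 b)"
      using sum[OF \<open>finite B\<close> B(1)] by blast
    also have "\<dots> \<le> (\<Sum>b\<in>B. norm u * d 0 b)"
    proof (intro sum_mono mult_right_mono)
      fix b assume "b \<in> B"
      then show "\<bar>u \<bullet> b\<bar> \<le> norm u" using Cauchy_Schwarz_ineq2[of u b] B(3) by simp
    qed simp
    also have "\<dots> = C * norm u" by (simp add: C_def sum_distrib_left mult.commute)
    finally show ?thesis .
  qed
  show ?thesis
  proof (rule that[of C])
    show "0 \<le> C" unfolding C_def by (intro sum_nonneg) simp
    \<comment> \<open>Left invariance removes \<open>x\<close>, so one constant serves all
      cosets.\<close>
    show "d (mul x u) (mul x v) \<le> C * norm (u - v)" if "u \<in> V" "v \<in> V" for x u v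
      using bound[of "v - u"] diff[OF that] that subspace_V
      by (simp add: inv subspace_diff norm_minus_commute)
  qed
qed

end


section \<open>Reduction of the Cauchy problem to a coset\<close>

locale horizontal_cauchy_problem = horizontal_abelian_subspace H \<iota> br mul V
  for H :: "nat \<Rightarrow> 'g::euclidean_space set" and \<iota> br mul V +
  fixes d :: "'g \<Rightarrow> 'g \<Rightarrow> real" and r :: nat and Y :: "nat \<Rightarrow> 'g \<Rightarrow> 'g" and \<Omega> :: "'g set"
    and T :: real and a :: "nat \<Rightarrow> real \<Rightarrow> 'g \<Rightarrow> real" and b :: "real \<Rightarrow> 'g \<Rightarrow> 'g" and x0 :: 'g
  assumes distance: "homogeneous_distance H \<iota> mul d"
    and Y_invariant: "\<And>i. i \<in> {1..r} \<Longrightarrow> left_invariant mul (Y i)"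
    and Y_V: "\<And>i. i \<in> {1..r} \<Longrightarrow> Y i 0 \<in> V"
    and open_\<Omega>: "open \<Omega>"
    and T_pos: "0 < T"
    and b_eq: "\<And>t x. \<lbrakk>t \<in> {0..T}; x \<in> \<Omega>\<rbrakk> \<Longrightarrow> b t x = (\<Sum>i=1..r. a i t x *\<^sub>R Y i x)"
    and a_continuous: "\<And>i. i \<in> {1..r} \<Longrightarrow> continuous_on ({0..T} \<times> \<Omega>) (\<lambda>(t, x). a i t x)"
    and a_lipschitz: "\<And>i. i \<in> {1..r} \<Longrightarrow>
      \<exists>L. \<forall>t\<in>{0..T}. \<forall>x\<in>\<Omega>. \<forall>y\<in>\<Omega>. \<bar>a i t x - a i t y\<bar> \<le> L * d x y"
    and x0: "x0 \<in> \<Omega>"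
begin

text \<open>The projection onto \<open>V\<close> only serves to define the reduced field on an open set of the
  ambient space; its solutions from \<open>0\<close> stay in \<open>V\<close>.\<close>

definition chart :: "'g \<Rightarrow> 'g" where
  "chart u = mul x0 (closest_point V u)"

definition reduced_domain :: "'g set" where
  "reduced_domain = {u. chart u \<in> \<Omega>}"

definition reduced_field :: "real \<Rightarrow> 'g \<Rightarrow> 'g" where
  "reduced_field t u = (\<Sum>i=1..r. a i t (chart u) *\<^sub>R Y i 0)"

lemma V_props: "convex V" "closed V" "V \<noteq> {}"
  using subspace_V by (auto simp: subspace_imp_convex closed_subspace dest: subspace_0)

lemma chart_V: "u \<in> V \<Longrightarrow> chart u = mul x0 u"
  by (simp add: chart_def closest_point_self)

lemma continuous_chart: "continuous_on A chart"
  unfolding chart_def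
  by (intro continuous_on_compose2[OF continuous_mul[of UNIV]] continuous_on_closest_point V_props)
    auto

lemma open_reduced_domain: "open reduced_domain"
  using open_vimage[OF open_\<Omega> continuous_chart] by (simp add: reduced_domain_def vimage_def)

lemma continuous_coefficient:
  assumes "i \<in> {1..r}" "continuous_on I \<gamma>" "I \<subseteq> {0..T}" "\<gamma> ` I \<subseteq> \<Omega>"
  shows "continuous_on I (\<lambda>s. a i s (\<gamma> s))"
proof -
  have "continuous_on I ((\<lambda>(t, x). a i t x) \<circ> (\<lambda>s. (s, \<gamma> s)))"
    using assms by (intro continuous_on_compose continuous_on_subset[OF a_continuous]
        continuous_on_Pair continuous_on_id) auto
  then show ?thesis by (simp add: o_def)
qed

lemma continuous_Y: "i \<in> {1..r} \<Longrightarrow> continuous_on A (Y i)"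
  by (intro differentiable_imp_continuous_on differentiable_at_imp_differentiable_on
      left_invariant_differentiable Y_invariant)

text \<open>The nearest-point projection does not increase Euclidean distances and \<open>d\<close>
  is bounded on cosets of \<open>V\<close> by a multiple of the norm, so a coefficient Lipschitz for
  \<open>d\<close> becomes Lipschitz for the norm after composition with
  \<open>chart\<close>.\<close>

lemma lipschitz_reduced_field: "\<exists>K. lipschitz_field reduced_field reduced_domain T K"
proof -
  obtain C where C: "0 \<le> C"
      "\<And>x u v. \<lbrakk>u \<in> V; v \<in> V\<rbrakk> \<Longrightarrow> d (mul x u) (mul x v) \<le> C * norm (u - v)"
    using homogeneous_distance_le_norm[OF distance] by metis
  obtain L where L: "\<And>i t x y. \<lbrakk>i \<in> {1..r}; t \<in> {0..T}; x \<in> \<Omega>; y \<in> \<Omega>\<rbrakk> \<Longrightarrow>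
      \<bar>a i t x - a i t y\<bar> \<le> L i * d x y"
    using a_lipschitz by metis
  have d_nonneg: "0 \<le> d x y" for x y
  proof -
    have "Metric_space UNIV d" using distance by (simp add: homogeneous_distance_def)
    then show ?thesis by (rule Metric_space.nonneg)
  qed
  have chart_lip: "d (chart u) (chart v) \<le> C * norm (u - v)" for u v
  proof -
    have "d (chart u) (chart v) \<le> C * norm (closest_point V u - closest_point V v)"
      unfolding chart_def using V_props by (intro C(2) closest_point_in_set)
    also have "\<dots> \<le> C * norm (u - v)"
      using closest_point_lipschitz[OF V_props, of u v] C(1)
      by (intro mult_left_mono) (auto simp: dist_norm)
    finally show ?thesis .
  qed
  \<comment> \<open>The given constants \<open>L i\<close> may be negative, hence the absolute
    values.\<close>
  define K where "K = (\<Sum>i=1..r. \<bar>L i\<bar> * C * norm (Y i 0))"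
  have "lipschitz_field reduced_field reduced_domain T K"
  proof
    show "open reduced_domain" by (rule open_reduced_domain)
    show "0 \<le> K" unfolding K_def using C(1) by (intro sum_nonneg) simp
    have "continuous_on ({0..T} \<times> reduced_domain) ((\<lambda>(t, x). a i t x) \<circ> (\<lambda>z. (fst z, chart (snd z))))"
      if "i \<in> {1..r}" for i
      by (intro continuous_on_compose continuous_on_subset[OF a_continuous[OF that]]
          continuous_on_Pair continuous_on_fst continuous_on_id
          continuous_on_compose2[OF continuous_chart[of UNIV]] continuous_on_snd)
        (auto simp: reduced_domain_def)
    then show "continuous_on ({0..T} \<times> reduced_domain) (\<lambda>(t, u). reduced_field t u)"
      unfolding reduced_field_def case_prod_unfold
      by (intro continuous_on_sum continuous_on_scaleR continuous_on_const)
        (simp add: o_def)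
    fix t u v assume t: "t \<in> {0..T}" and uv: "u \<in> reduced_domain" "v \<in> reduced_domain"
    have "norm (reduced_field t u - reduced_field t v) =
        norm (\<Sum>i=1..r. (a i t (chart u) - a i t (chart v)) *\<^sub>R Y i 0)"
      by (simp add: reduced_field_def sum_subtractf scaleR_diff_left)
    also have "\<dots> \<le> (\<Sum>i=1..r. \<bar>L i\<bar> * C * norm (Y i 0) * norm (u - v))"
    proof (rule sum_norm_le)
      fix i assume i: "i \<in> {1..r}"
      have "\<bar>a i t (chart u) - a i t (chart v)\<bar> \<le> L i * d (chart u) (chart v)"
        using L[OF i t] uv by (simp add: reduced_domain_def)
      also have "\<dots> \<le> \<bar>L i\<bar> * d (chart u) (chart v)"
        using d_nonneg by (intro mult_right_mono) auto
      also have "\<dots> \<le> \<bar>L i\<bar> * (C * norm (u - v))"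
        by (intro mult_left_mono chart_lip) simp
      finally show "norm ((a i t (chart u) - a i t (chart v)) *\<^sub>R Y i 0) \<le>
          \<bar>L i\<bar> * C * norm (Y i 0) * norm (u - v)"
        using mult_right_mono[of _ _ "norm (Y i 0)"] by (fastforce simp: ac_simps)
    qed
    also have "\<dots> = K * norm (u - v)" by (simp add: K_def sum_distrib_right)
    finally show "norm (reduced_field t u - reduced_field t v) \<le> K * norm (u - v)" .
  qed
  then show ?thesis ..
qed

section \<open>Transfer of solutions between the reduced and the original problem\<close>

definition lipschitz_const :: real where
  "lipschitz_const = (SOME K. lipschitz_field reduced_field reduced_domain T K)"

interpretation reduced: lipschitz_field reduced_field reduced_domain T lipschitz_const
  unfolding lipschitz_const_def using lipschitz_reduced_field by (rule someI_ex)

text \<open>Since \<open>Y i u = Y i 0\<close> on \<open>V\<close>, left translation carries the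
  frame frozen at the identity to the actual frame at \<open>mul x u\<close>.\<close>

lemma left_invariant_combination:
  assumes u: "u \<in> V"
  shows "frechet_derivative (mul x) (at u) (\<Sum>i=1..r. c i *\<^sub>R Y i 0) = (\<Sum>i=1..r. c i *\<^sub>R Y i (mul x u))"
proof -
  have "Y i (mul x u) = frechet_derivative (mul x) (at u) (Y i 0)" if "i \<in> {1..r}" for i
    using Y_invariant[OF that] left_invariant_V[OF Y_invariant Y_V u] that
    by (simp add: left_invariant_def)
  then show ?thesis
    by (simp add: linear_sum[OF linear_frechet_derivative_mul]
        linear_scale[OF linear_frechet_derivative_mul])
qed

lemma combination_in_V: "(\<Sum>i=1..r. c i *\<^sub>R Y i 0) \<in> V"
  by (intro subspace_sum subspace_scale subspace_V Y_V)

text \<open>Starting from \<open>0\<close>, the integral equation expresses \<open>u t\<close> as a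
  combination of the vectors \<open>Y i 0\<close> with the integrated coefficients.\<close>

lemma reduced_solution_in_V:
  assumes u: "cauchy_solution reduced_field reduced_domain 0 \<tau> u" and "\<tau> \<le> T" and t: "t \<in> {0..\<tau>}"
  shows "u t \<in> V"
proof -
  have cont: "continuous_on {0..t} (\<lambda>s. a i s (chart (u s)))" if "i \<in> {1..r}" for i
  proof (rule continuous_coefficient[OF that])
    have "continuous_on {0..t} u"
      using u t by (auto simp: cauchy_solution_def intro: continuous_on_subset)
    then show "continuous_on {0..t} (\<lambda>s. chart (u s))"
      by (rule continuous_on_compose2[OF continuous_chart[of UNIV]]) auto
  qed (use u t \<open>\<tau> \<le> T\<close> in \<open>auto simp: cauchy_solution_def reduced_domain_def\<close>)
  have "((\<lambda>s. reduced_field s (u s)) has_integral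
      (\<Sum>i=1..r. integral {0..t} (\<lambda>s. a i s (chart (u s))) *\<^sub>R Y i 0)) {0..t}"
    unfolding reduced_field_def
    by (intro has_integral_sum has_integral_scaleR_left integrable_integral
        integrable_continuous_interval cont) auto
  moreover have "((\<lambda>s. reduced_field s (u s)) has_integral u t) {0..t}"
  proof -
    have "((\<lambda>s. reduced_field s (u s)) has_integral (u t - u 0)) {0..t}" "u 0 = 0"
      using u t unfolding cauchy_solution_def by blast+
    then show ?thesis by simp
  qed
  ultimately have "u t = (\<Sum>i=1..r. integral {0..t} (\<lambda>s. a i s (chart (u s))) *\<^sub>R Y i 0)"
    by (rule has_integral_unique[rotated])
  then show ?thesis using combination_in_V by simp
qed

text \<open>Chain rule for left translation by \<open>x0\<close>. Membership of the curve in
  \<open>\<Omega>\<close> is settled first, because the expansion of \<open>b\<close> in the frame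
  is available only there.\<close>

lemma solution_of_reduced:
  assumes u: "cauchy_solution reduced_field reduced_domain 0 \<tau> u" and "\<tau> \<le> T"
  shows "cauchy_solution b \<Omega> x0 \<tau> (\<lambda>t. mul x0 (u t))"
proof -
  have V: "u t \<in> V" if "t \<in> {0..\<tau>}" for t by (rule reduced_solution_in_V[OF u \<open>\<tau> \<le> T\<close> that])
  have \<Omega>: "mul x0 (u t) \<in> \<Omega>" if "t \<in> {0..\<tau>}" for t
  proof -
    have "chart (u t) \<in> \<Omega>" using u that by (simp add: cauchy_solution_def reduced_domain_def)
    then show ?thesis using chart_V[OF V[OF that]] by simp
  qed
  have "((\<lambda>t. mul x0 (u t)) has_vector_derivative b t (mul x0 (u t))) (at t within {0..\<tau>})"
    if t: "t \<in> {0..\<tau>}" for t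
  proof -
    have "(mul x0 has_derivative frechet_derivative (mul x0) (at (u t))) (at (u t))"
      using mul_differentiable frechet_derivative_works by blast
    moreover have "(u has_derivative (\<lambda>h. h *\<^sub>R reduced_field t (u t))) (at t within {0..\<tau>})"
      using reduced.solution_has_vector_derivative[OF u \<open>\<tau> \<le> T\<close> t]
      by (simp add: has_vector_derivative_def)
    ultimately have "((\<lambda>t. mul x0 (u t)) has_derivative
        (\<lambda>h. frechet_derivative (mul x0) (at (u t)) (h *\<^sub>R reduced_field t (u t)))) (at t within {0..\<tau>})"
      using has_derivative_compose by blast
    then have "((\<lambda>t. mul x0 (u t)) has_vector_derivative
        frechet_derivative (mul x0) (at (u t)) (reduced_field t (u t))) (at t within {0..\<tau>})"
      by (simp add: has_vector_derivative_def linear_scale[OF linear_frechet_derivative_mul])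
    moreover have "frechet_derivative (mul x0) (at (u t)) (reduced_field t (u t)) = b t (mul x0 (u t))"
      unfolding reduced_field_def left_invariant_combination[OF V[OF t]]
      using b_eq[of t "mul x0 (u t)"] t \<open>\<tau> \<le> T\<close> \<Omega>[OF t] chart_V[OF V[OF t]] by simp
    ultimately show ?thesis by simp
  qed
  note deriv = this
  have "((\<lambda>s. b s (mul x0 (u s))) has_integral (mul x0 (u t) - mul x0 (u 0))) {0..t}"
    if t: "t \<in> {0..\<tau>}" for t
  proof (rule fundamental_theorem_of_calculus)
    show "((\<lambda>t. mul x0 (u t)) has_vector_derivative b s (mul x0 (u s))) (at s within {0..t})"
      if "s \<in> {0..t}" for s
      by (rule has_vector_derivative_within_subset[OF deriv]) (use that t in auto)
  qed (use t in auto)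
  moreover have "continuous_on {0..\<tau>} (\<lambda>t. mul x0 (u t))"
    using u by (intro continuous_on_compose2[OF continuous_mul[of UNIV]])
      (auto simp: cauchy_solution_def)
  moreover have "mul x0 (u 0) = x0" using u by (simp add: cauchy_solution_def mul_0_right)
  ultimately show ?thesis using \<Omega> by (simp add: cauchy_solution_def)
qed

text \<open>Since \<open>\<gamma>\<close> is not known in advance to stay in the coset of
  \<open>x0\<close>, \<open>u\<close> is built by integrating the coefficients along
  \<open>\<gamma>\<close>; \<open>curve_in_coset\<close> then identifies \<open>\<gamma>\<close>
  with the translate of \<open>u\<close>.\<close>

lemma reduced_of_solution:
  assumes \<gamma>: "cauchy_solution b \<Omega> x0 \<tau> \<gamma>" and \<tau>: "\<tau> \<le> T" "0 \<le> \<tau>"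
  obtains u where "cauchy_solution reduced_field reduced_domain 0 \<tau> u"
    "\<And>t. t \<in> {0..\<tau>} \<Longrightarrow> \<gamma> t = mul x0 (u t)"
proof -
  have \<gamma>_cont: "continuous_on {0..\<tau>} \<gamma>" and \<gamma>_\<Omega>: "\<And>t. t \<in> {0..\<tau>} \<Longrightarrow> \<gamma> t \<in> \<Omega>"
    and \<gamma>_0: "\<gamma> 0 = x0"
    using \<gamma> by (auto simp: cauchy_solution_def)
  have a_cont: "continuous_on {0..\<tau>} (\<lambda>s. a i s (\<gamma> s))" if "i \<in> {1..r}" for i
    using that \<gamma>_cont \<gamma>_\<Omega> \<tau> by (intro continuous_coefficient) auto
  have b_\<gamma>: "b s (\<gamma> s) = (\<Sum>i=1..r. a i s (\<gamma> s) *\<^sub>R Y i (\<gamma> s))" if "s \<in> {0..\<tau>}" for s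
    using b_eq \<gamma>_\<Omega> \<tau> that by simp
  have "continuous_on {0..\<tau>} (\<lambda>s. \<Sum>i=1..r. a i s (\<gamma> s) *\<^sub>R Y i (\<gamma> s))"
    using \<gamma>_cont by (intro continuous_on_sum continuous_on_scaleR a_cont
        continuous_on_compose2[OF continuous_Y[of _ UNIV]]) auto
  then have "continuous_on {0..\<tau>} (\<lambda>s. b s (\<gamma> s))"
    by (rule continuous_on_eq) (simp add: b_\<gamma>)
  note \<gamma>_deriv = cauchy_solution_has_vector_derivative[OF \<gamma> this]
  define v where "v t = (\<Sum>i=1..r. a i t (\<gamma> t) *\<^sub>R Y i 0)" for t
  define u where "u t = (\<Sum>i=1..r. integral {0..t} (\<lambda>s. a i s (\<gamma> s)) *\<^sub>R Y i 0)" for t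
  have u_deriv: "(u has_vector_derivative v t) (at t within {0..\<tau>})" if t: "t \<in> {0..\<tau>}" for t
  proof -
    have "((\<lambda>t. integral {0..t} (\<lambda>s. a i s (\<gamma> s))) has_real_derivative a i t (\<gamma> t))
        (at t within {0..\<tau>})" if "i \<in> {1..r}" for i
      using integral_has_real_derivative[OF a_cont[OF that] t] .
    then have "(u has_vector_derivative
        (\<Sum>i=1..r. integral {0..t} (\<lambda>s. a i s (\<gamma> s)) *\<^sub>R 0 + a i t (\<gamma> t) *\<^sub>R Y i 0)) (at t within {0..\<tau>})"
      unfolding u_def
      by (intro has_vector_derivative_sum has_vector_derivative_scaleR has_vector_derivative_const)
    then show ?thesis by (simp add: v_def)
  qed
  have u_V: "u t \<in> V" and v_V: "v t \<in> V" for t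
    unfolding u_def v_def by (rule combination_in_V)+
  have u_0: "u 0 = 0" by (simp add: u_def)
  have \<gamma>_eq: "\<gamma> t = mul x0 (u t)" if t: "t \<in> {0..\<tau>}" for t
    unfolding \<gamma>_0[symmetric]
  proof (rule curve_in_coset[where v = v and \<tau> = \<tau>])
    fix t assume t: "t \<in> {0..\<tau>}"
    have "frechet_derivative (mul (\<gamma> t)) (at 0) (v t) = b t (\<gamma> t)"
      unfolding v_def using left_invariant_combination[of 0 "\<gamma> t"] b_\<gamma>[OF t] subspace_V
      by (simp add: subspace_0 mul_0_right)
    then show "(\<gamma> has_vector_derivative frechet_derivative (mul (\<gamma> t)) (at 0) (v t))
        (at t within {0..\<tau>})"
      using \<gamma>_deriv[OF t] by simp
  qed (use u_deriv u_V v_V u_0 t in auto)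
  have chart_u: "chart (u t) = \<gamma> t" if "t \<in> {0..\<tau>}" for t
    using chart_V[OF u_V] \<gamma>_eq[OF that] by simp
  have "((\<lambda>s. reduced_field s (u s)) has_integral (u t - u 0)) {0..t}" if t: "t \<in> {0..\<tau>}" for t
  proof (rule fundamental_theorem_of_calculus)
    fix s assume s: "s \<in> {0..t}"
    then have "v s = reduced_field s (u s)"
      using chart_u[of s] t by (simp add: v_def reduced_field_def)
    then show "(u has_vector_derivative reduced_field s (u s)) (at s within {0..t})"
      using u_deriv[of s] s t by (auto intro: has_vector_derivative_within_subset)
  qed (use t in auto)
  moreover have "continuous_on {0..\<tau>} u"
    unfolding continuous_on_eq_continuous_within
    using u_deriv has_vector_derivative_continuous by blast
  moreover have "u t \<in> reduced_domain" if "t \<in> {0..\<tau>}" for t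
    using chart_u[OF that] \<gamma>_\<Omega>[OF that] by (simp add: reduced_domain_def)
  ultimately have "cauchy_solution reduced_field reduced_domain 0 \<tau> u"
    using u_0 unfolding cauchy_solution_def by blast
  then show ?thesis using \<gamma>_eq that by blast
qed

lemma unique_solution:
  assumes \<gamma>: "cauchy_solution b \<Omega> x0 \<tau> \<gamma>" and \<eta>: "cauchy_solution b \<Omega> x0 \<tau> \<eta>"
    and \<tau>: "\<tau> \<le> T" and t: "t \<in> {0..\<tau>}"
  shows "\<gamma> t = \<eta> t"
proof -
  have "0 \<le> \<tau>" using t by auto
  obtain u v where
    u: "cauchy_solution reduced_field reduced_domain 0 \<tau> u" "\<gamma> t = mul x0 (u t)" and
    v: "cauchy_solution reduced_field reduced_domain 0 \<tau> v" "\<eta> t = mul x0 (v t)"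
    using reduced_of_solution[OF \<gamma> \<tau> \<open>0 \<le> \<tau>\<close>] reduced_of_solution[OF \<eta> \<tau> \<open>0 \<le> \<tau>\<close>] t by metis
  then show ?thesis using reduced.solution_unique[OF u(1) v(1) \<tau> t] by simp
qed

text \<open>The limit \<open>z\<close> lies in the closed set \<open>V\<close>, so
  \<open>chart z\<close> is \<open>mul x0 z\<close>. As \<open>z\<close> is outside the open reduced
  domain, \<open>mul x0 z\<close> is outside \<open>\<Omega>\<close>, yet it is a limit of points of
  \<open>\<Omega>\<close>.\<close>

lemma exits_of_reduced:
  assumes \<tau>: "\<tau> \<in> {0<..T}" and u: "exits_through_boundary reduced_field reduced_domain 0 \<tau> u"
  shows "exits_through_boundary b \<Omega> x0 \<tau> (\<lambda>t. mul x0 (u t))"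
proof -
  have sol: "cauchy_solution reduced_field reduced_domain 0 s u" if "s \<in> {0..<\<tau>}" for s
    using u that by (simp add: exits_through_boundary_def)
  obtain z where z: "z \<in> frontier reduced_domain" "(u \<longlongrightarrow> z) (at_left \<tau>)"
    using u by (auto simp: exits_through_boundary_def)
  have near: "\<forall>\<^sub>F t in at_left \<tau>. t \<in> {0<..<\<tau>}"
    using \<tau> by (intro eventually_at_left_real) auto
  have u_V: "u t \<in> V" if "t \<in> {0..<\<tau>}" for t
    using reduced_solution_in_V[OF sol[OF that]] that \<tau> by auto
  have sol_b: "cauchy_solution b \<Omega> x0 s (\<lambda>t. mul x0 (u t))" if "s \<in> {0..<\<tau>}" for s
    using solution_of_reduced[OF sol[OF that]] that \<tau> by auto
  have "z \<in> V"
    by (rule Lim_in_closed_set[OF V_props(2) eventually_mono[OF near] _ z(2)]) (auto intro: u_V)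
  have "isCont (mul x0) z"
    using continuous_mul[of UNIV] by (simp add: continuous_on_eq_continuous_at)
  then have lim: "((\<lambda>t. mul x0 (u t)) \<longlongrightarrow> mul x0 z) (at_left \<tau>)"
    using z(2) by (rule isCont_tendsto_compose)
  have "mul x0 (u t) \<in> closure \<Omega>" if "t \<in> {0<..<\<tau>}" for t
    using sol_b[of t] that closure_subset[of \<Omega>] by (auto simp: cauchy_solution_def)
  then have "mul x0 z \<in> closure \<Omega>"
    by (intro Lim_in_closed_set[OF closed_closure eventually_mono[OF near] _ lim]) auto
  moreover have "z \<notin> reduced_domain"
    using z(1) open_reduced_domain by (simp add: frontier_def interior_open)
  then have "mul x0 z \<notin> \<Omega>"
    using chart_V[OF \<open>z \<in> V\<close>] by (simp add: reduced_domain_def)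
  ultimately have "mul x0 z \<in> frontier \<Omega>"
    using open_\<Omega> by (simp add: frontier_def interior_open)
  then show ?thesis using sol_b lim by (auto simp: exits_through_boundary_def)
qed

lemma solution_exists_or_exits:
  "(\<exists>\<gamma>. cauchy_solution b \<Omega> x0 T \<gamma>) \<or> (\<exists>\<tau>\<in>{0<..T}. \<exists>\<gamma>. exits_through_boundary b \<Omega> x0 \<tau> \<gamma>)"
proof -
  have "0 \<in> reduced_domain"
    using x0 subspace_V by (simp add: reduced_domain_def chart_V subspace_0 mul_0_right)
  from reduced.solution_or_exit[OF this T_pos] show ?thesis
    using solution_of_reduced[of T] exits_of_reduced by blast
qed

end

text \<open>Uniqueness is stated on every interval \<open>{0..\<tau>}\<close>, so it also compares
  solutions that end before \<open>T\<close>. Existence is a dichotomy because a curve may leave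
  \<open>\<Omega>\<close> through its boundary by time \<open>T\<close>.\<close>

theorem theorem4p3:
  fixes H :: "nat \<Rightarrow> 'g::euclidean_space set"
    and \<iota> r :: nat
    and br mul :: "'g \<Rightarrow> 'g \<Rightarrow> 'g"
    and d :: "'g \<Rightarrow> 'g \<Rightarrow> real"
    and S :: "('g \<Rightarrow> 'g) set"
    and Y :: "nat \<Rightarrow> 'g \<Rightarrow> 'g"
    and \<Omega> :: "'g set"
    and T :: real
    and a :: "nat \<Rightarrow> real \<Rightarrow> 'g \<Rightarrow> real"
    and b :: "real \<Rightarrow> 'g \<Rightarrow> 'g"
    and x0 :: 'g
  assumes "homogeneous_group H \<iota> br mul"
    and "homogeneous_distance H \<iota> mul d"
    and "S \<subseteq> layer_fields H mul 1"
    and "involutive_subalgebra S"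
    and "basis_of_fields S r Y"
    and "open \<Omega>"
    and "T > 0"
    and "\<And>t x. \<lbrakk>t \<in> {0..T}; x \<in> \<Omega>\<rbrakk> \<Longrightarrow> b t x = (\<Sum>i=1..r. a i t x *\<^sub>R Y i x)"
    and "\<And>i. i \<in> {1..r} \<Longrightarrow> continuous_on ({0..T} \<times> \<Omega>) (\<lambda>(t, x). a i t x)"
    and "\<And>i. i \<in> {1..r} \<Longrightarrow>
           \<exists>L. \<forall>t\<in>{0..T}. \<forall>x\<in>\<Omega>. \<forall>y\<in>\<Omega>. \<bar>a i t x - a i t y\<bar> \<le> L * d x y"
    and "x0 \<in> \<Omega>"
  shows "(\<forall>\<tau>\<in>{0<..T}. \<forall>\<gamma> \<eta>. cauchy_solution b \<Omega> x0 \<tau> \<gamma> \<longrightarrow> cauchy_solution b \<Omega> x0 \<tau> \<eta> \<longrightarrow>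
            (\<forall>t\<in>{0..\<tau>}. \<gamma> t = \<eta> t)) \<and>
         ((\<exists>\<gamma>. cauchy_solution b \<Omega> x0 T \<gamma>) \<or>
          (\<exists>\<tau>\<in>{0<..T}. \<exists>\<gamma>. exits_through_boundary b \<Omega> x0 \<tau> \<gamma>))"
proof -
  let ?V = "{X 0 | X. X \<in> S}"
  interpret homogeneous_group H \<iota> br mul by (rule assms(1))
  have S: "left_invariant mul X" "X 0 \<in> H 1" if "X \<in> S" for X
    using assms(3) that by (auto simp: layer_fields_def)
  have Y: "Y i \<in> S" if "i \<in> {1..r}" for i
    using assms(5) that by (simp add: basis_of_fields_def)
  interpret horizontal_cauchy_problem H \<iota> br mul ?V d r Y \<Omega> T a b x0
  proof
    show "subspace ?V"
    proof (rule subspaceI)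
      show "0 \<in> ?V" using assms(4) by (force simp: involutive_subalgebra_def)
      show "x + y \<in> ?V" if xy: "x \<in> ?V" "y \<in> ?V" for x y
      proof -
        obtain X Z where XZ: "X \<in> S" "Z \<in> S" "x = X 0" "y = Z 0" using xy by blast
        then have "(\<lambda>x. X x + Z x) \<in> S" using assms(4) by (simp add: involutive_subalgebra_def)
        with XZ show ?thesis by force
      qed
      show "c *\<^sub>R x \<in> ?V" if x: "x \<in> ?V" for c x
      proof -
        obtain X where X: "X \<in> S" "x = X 0" using x by blast
        then have "(\<lambda>x. c *\<^sub>R X x) \<in> S" using assms(4) by (simp add: involutive_subalgebra_def)
        with X show ?thesis by force
      qed
    qed
    show "?V \<subseteq> H 1" using S by auto
    show "br x y = 0" if "x \<in> ?V" "y \<in> ?V" for x y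
      using that involutive_bracket_0[OF assms(3,4)] by auto
    show "left_invariant mul (Y i)" if "i \<in> {1..r}" for i using S(1) Y[OF that] .
    show "Y i 0 \<in> ?V" if "i \<in> {1..r}" for i using Y[OF that] by auto
  qed (use assms in auto)
  show ?thesis
    using unique_solution solution_exists_or_exits by auto
qed

end
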